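(* Let $n\ge2$ be even, and consider $\mathbb{R}^{1,n-1}$ with Cartesian coordinates $x^1,\dots,x^n$, a smooth tetrad and its genvector $h^\mu$. Let $t\in\mathbb{C}\otimes\Lambda^{[h]}(\mathbb{R}^{1,n-1})$ be a Hermitian idempotent, let $m$ be a real constant, let $A_\mu=A_\mu(x)$ ($\mu=1,\dots,n$) be components of a covector field with values in $L(t)$, and let $\psi_0=\psi_0(x^2,\dots,x^n)\in I(t)$ be a given smooth compactly supported genform. Consider the Cauchy problem for $\psi=\psi(x)\in I(t)$ $$\text{(P1)}\qquad h^\mu(\partial_\mu\psi+\psi A_\mu)+im\psi=0\ \text{ for }x^1>0,\qquad \psi=\psi_0\ \text{ for }x^1=0,$$ and the Cauchy problem for $\Psi=\Psi(x)\in\mathbb{C}\otimes\Lambda^{[h]}(\mathbb{R}^{1,n-1})$ $$\text{(P2)}\qquad h^\mu(\partial_\mu\Psi+\Psi A_\mu)+im\Psi=0\ \text{ for }x^1>0,\qquad \Psi=\psi_0\ \text{ for }x^1=0.$$ Then: I) If a genform $\psi\in I(t)$ is a solution of (P1), then the genform $\Psi\equiv\psi\in\mathbb{C}\otimes\Lambda^{[h]}(\mathbb{R}^{1,n-1})$ satisfies (P2). II) If a genform $\Psi\in\mathbb{C}\otimes\Lambda^{[h]}(\mathbb{R}^{1,n-1})$ is a solution of (P2), then $\Psi$ belongs to $I(t)$ and $\psi=\Psi$ satisfies (P1).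
   Context: Clifford algebra. $\mathcal{C}\ell(1,n-1)$ is the real Clifford algebra with identity $e$ and generators $e^1,\dots,e^n$ satisfying $e^ae^b+e^be^a=2\eta^{ab}e$, where $\eta=\mathrm{diag}(1,-1,\dots,-1)$. The generators do not depend on $x$. Summation over repeated indices is understood, $\partial_\mu=\partial/\partial x^\mu$, and $i$ is the imaginary unit. Tetrad and genvector. A (smooth) tetrad is a family of smooth real functions $y^\mu_a$ ($\mu,a=1,\dots,n$) with $y^\mu_ay^\nu_b\eta^{ab}=\eta^{\mu\nu}$; the genvector is $h^\mu=y^\mu_ae^a$, so $h^\mu h^\nu+h^\nu h^\mu=2\eta^{\mu\nu}e$. Genforms. A complexified genform $U\in\mathbb{C}\otimes\Lambda^{[h]}(\mathbb{R}^{1,n-1})$ is an expression $U=ue+\sum_{k=1}^n\frac1{k!}u_{\mu_1\dots\mu_k}h^{\mu_1}\wedge\dots\wedge h^{\mu_k}$ with complex antisymmetric covariant tensor fields as coefficients, where $\wedge$ denotes the antisymmetrized Clifford product. Equivalently, $U$ is a function of $x$ with values in $\mathbb{C}\otimes\mathcal{C}\ell(1,n-1)$; genforms are multiplied pointwise by the Clifford product and differentiated as Clifford-algebra-valued functions. Hermitian conjugation. $V^\dagger:=\beta\,\widetilde{\overline{V}}\,\beta$, where $\beta=e^1$, the tilde is reversion (the linear anti-automorphism fixing each $e^a$), and the bar is complex conjugation of coefficients with respect to the real algebra $\mathcal{C}\ell(1,n-1)$. Hermitian idempotent. An element $t\in\mathbb{C}\otimes\Lambda^{[h]}(\mathbb{R}^{1,n-1})$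 with $t^2=t$, $t^\dagger=t$ and $\partial_\mu t=0$ for all $\mu=1,\dots,n$. Related sets: $I(t)=\{U\in\mathbb{C}\otimes\Lambda^{[h]}(\mathbb{R}^{1,n-1}): U=Ut\}$, $K(t)=\{U\in I(t): U=tU\}$, $L(t)=\{U\in K(t): U^\dagger=-U\}$. "Solution" means a classical solution: a genform that is continuously differentiable on $\{x^1\ge0\}$, satisfying the equation for $x^1>0$ and the initial condition at $x^1=0$. *)

theory Defs
  imports "HOL-Analysis.Analysis"
begin

text \<open>
  Coordinates are indexed by a finite linearly ordered type \<open>'n\<close>, so that \<open>n = CARD('n)\<close>; the
  coordinate $x^1$ is the one with the least index.
\<close>

definition i1 :: "'n::{finite,linorder}" where
  "i1 = Min UNIV"

definition eta :: "'n::{finite,linorder} \<Rightarrow> 'n \<Rightarrow> real" where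
  "eta a b = (if a \<noteq> b then 0 else if a = i1 then 1 else -1)"


type_synonym 'n pt = "(real, 'n) vec"


subsection \<open>The complexified Clifford algebra\<close>

text \<open>
  An element is the vector of its coefficients in the basis $e^A = e^{a_1} \cdots e^{a_k}$, where
  $A = \{a_1 < \dots < a_k\}$. The Clifford product is \<open>\<odot>\<close>; the \<open>*\<close> and \<open>1\<close> of the library are
  componentwise on this type and are not used.
\<close>

type_synonym 'n cl = "complex ^ ('n set)"

definition basis :: "'n::finite set \<Rightarrow> 'n cl" where
  "basis A = axis A 1"

abbreviation e_unit :: "'n::finite cl" where
  "e_unit \<equiv> basis {}"

abbreviation e_gen :: "'n::finite \<Rightarrow> 'n cl" where
  "e_gen a \<equiv> basis {a}"

text \<open>
  $e^A e^B = \pm e^{A \mathbin{\triangle} B}$. Sorting the word $e^A e^B$ exchanges each pair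
  $a \in A$, $b \in B$ with $b < a$ exactly once, and each common index contributes its square
  $\eta^{aa}$.
\<close>

definition sgn_pair :: "'n::{finite,linorder} \<Rightarrow> 'n \<Rightarrow> real" where
  "sgn_pair a b = (if b < a then -1 else if a = b then eta a a else 1)"

definition sgn_prod :: "'n::{finite,linorder} set \<Rightarrow> 'n set \<Rightarrow> real" where
  "sgn_prod A B = (\<Prod>a\<in>A. \<Prod>b\<in>B. sgn_pair a b)"

definition cl_mult :: "'n::{finite,linorder} cl \<Rightarrow> 'n cl \<Rightarrow> 'n cl"  (infixl "\<odot>" 70) where
  "X \<odot> Y = (\<Sum>A\<in>UNIV. \<Sum>B\<in>UNIV. (of_real (sgn_prod A B) * X $ A * Y $ B) *s basis (sym_diff A B))"

definition cl_cnj :: "'n::finite cl \<Rightarrow> 'n cl" where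
  "cl_cnj X = (\<chi> A. cnj (X $ A))"

text \<open>Reversing a word of $k$ distinct generators takes $k(k-1)/2$ transpositions.\<close>

definition cl_rev :: "'n::finite cl \<Rightarrow> 'n cl" where
  "cl_rev X = (\<chi> A. (-1) ^ (card A choose 2) * X $ A)"

definition cl_dagger :: "'n::{finite,linorder} cl \<Rightarrow> 'n cl" where
  "cl_dagger V = e_gen i1 \<odot> cl_rev (cl_cnj V) \<odot> e_gen i1"


subsection \<open>Algebra laws\<close>

lemma sgn_pair_square: "sgn_pair a b * sgn_pair a b = 1"
  by (simp add: sgn_pair_def eta_def)

lemma sgn_prod_square: "sgn_prod A B * sgn_prod A B = 1"
  by (simp add: sgn_prod_def sgn_pair_square flip: prod.distrib)

lemma prod_sym_diff:
  fixes f :: "'a::finite \<Rightarrow> real"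
  assumes "\<And>a. f a * f a = 1"
  shows "prod f (sym_diff A B) = prod f A * prod f B"
proof -
  have A: "prod f A = prod f (A - B) * prod f (A \<inter> B)"
    by (subst prod.union_disjoint[symmetric]) (auto intro: arg_cong[where f = "prod f"])
  have B: "prod f B = prod f (B - A) * prod f (A \<inter> B)"
    by (subst prod.union_disjoint[symmetric]) (auto intro: arg_cong[where f = "prod f"])
  have "prod f (A \<inter> B) * prod f (A \<inter> B) = 1"
    by (simp add: assms flip: prod.distrib)
  moreover have "prod f (sym_diff A B) = prod f (A - B) * prod f (B - A)"
    by (rule prod.union_disjoint) auto
  ultimately show ?thesis by (simp add: A B)
qed

lemma sgn_prod_sym_diff_left: "sgn_prod (sym_diff A B) C = sgn_prod A C * sgn_prod B C"
  unfolding sgn_prod_def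
  by (rule prod_sym_diff) (simp add: sgn_pair_square flip: prod.distrib)

lemma sgn_prod_sym_diff_right: "sgn_prod A (sym_diff B C) = sgn_prod A B * sgn_prod A C"
  unfolding sgn_prod_def by (simp add: prod_sym_diff sgn_pair_square flip: prod.distrib)

lemma cl_expand: "X = (\<Sum>A\<in>UNIV. (X $ A) *s basis A)"
  by (simp add: vec_eq_iff basis_def axis_def if_distrib cong: if_cong)

lemma cl_mult_add_left: "(X + Y) \<odot> Z = X \<odot> Z + Y \<odot> Z"
  by (simp add: cl_mult_def algebra_simps sum.distrib vector_sadd_rdistrib)

lemma cl_mult_add_right: "X \<odot> (Y + Z) = X \<odot> Y + X \<odot> Z"
  by (simp add: cl_mult_def algebra_simps sum.distrib vector_sadd_rdistrib)

lemma cl_mult_scale_left: "(c *s X) \<odot> Y = c *s (X \<odot> Y)"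
  by (simp add: cl_mult_def vec_eq_iff sum_distrib_left mult_ac)

lemma cl_mult_scale_right: "X \<odot> (c *s Y) = c *s (X \<odot> Y)"
  by (simp add: cl_mult_def vec_eq_iff sum_distrib_left mult_ac)

lemma cl_mult_zero [simp]: "0 \<odot> X = 0" "X \<odot> 0 = 0"
  by (simp_all add: cl_mult_def)

lemma cl_mult_sum_left: "(\<Sum>i\<in>I. f i) \<odot> Z = (\<Sum>i\<in>I. f i \<odot> Z)"
  by (induction I rule: infinite_finite_induct) (simp_all add: cl_mult_add_left)

lemma cl_mult_sum_right: "Z \<odot> (\<Sum>i\<in>I. f i) = (\<Sum>i\<in>I. Z \<odot> f i)"
  by (induction I rule: infinite_finite_induct) (simp_all add: cl_mult_add_right)

lemma basis_mult: "basis A \<odot> basis B = of_real (sgn_prod A B) *s basis (sym_diff A B)"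
proof -
  have "basis A \<odot> basis B = (\<Sum>C\<in>UNIV. if C = A then of_real (sgn_prod A B) *s basis (sym_diff A B) else 0)"
    unfolding cl_mult_def
  proof (rule sum.cong[OF refl])
    fix C
    have "(\<Sum>D\<in>UNIV. (of_real (sgn_prod C D) * basis A $ C * basis B $ D) *s basis (sym_diff C D))
        = (\<Sum>D\<in>UNIV. if D = B then (if C = A then of_real (sgn_prod A B) *s basis (sym_diff A B) else 0) else 0)"
      by (rule sum.cong[OF refl]) (auto simp: basis_def axis_def)
    then show "(\<Sum>D\<in>UNIV. (of_real (sgn_prod C D) * basis A $ C * basis B $ D) *s basis (sym_diff C D))
        = (if C = A then of_real (sgn_prod A B) *s basis (sym_diff A B) else 0)"
      by simp
  qed
  then show ?thesis by simp
qed

lemma sym_diff_assoc: "sym_diff (sym_diff A B) C = sym_diff A (sym_diff B C)"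
  by blast

lemma basis_mult_assoc: "basis A \<odot> basis B \<odot> basis C = basis A \<odot> (basis B \<odot> basis C)"
  by (simp add: basis_mult cl_mult_scale_left cl_mult_scale_right sym_diff_assoc
      sgn_prod_sym_diff_left sgn_prod_sym_diff_right mult_ac)

lemma cl_mult_assoc: "X \<odot> Y \<odot> Z = X \<odot> (Y \<odot> Z)"
proof -
  have 1: "basis A \<odot> basis B \<odot> Z = basis A \<odot> (basis B \<odot> Z)" for A B :: "'a set"
    by (subst (1 2) cl_expand[of Z])
      (simp only: cl_mult_sum_right cl_mult_scale_right basis_mult_assoc)
  have 2: "basis A \<odot> Y \<odot> Z = basis A \<odot> (Y \<odot> Z)" for A :: "'a set"
    by (subst (1 2) cl_expand[of Y])
      (simp only: cl_mult_sum_right cl_mult_sum_left cl_mult_scale_left cl_mult_scale_right 1)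
  show ?thesis
    by (subst (1 2) cl_expand[of X]) (simp only: cl_mult_sum_left cl_mult_scale_left 2)
qed

lemma cl_mult_unit [simp]: "e_unit \<odot> X = X" "X \<odot> e_unit = X"
proof -
  show "e_unit \<odot> X = X"
    by (subst (1 2) cl_expand[of X])
      (simp add: cl_mult_sum_right cl_mult_scale_right basis_mult sgn_prod_def)
  show "X \<odot> e_unit = X"
    by (subst (1 2) cl_expand[of X])
      (simp add: cl_mult_sum_left cl_mult_scale_left basis_mult sgn_prod_def)
qed

lemma e_gen_anticommute:
  "e_gen a \<odot> e_gen b + e_gen b \<odot> e_gen a = (2 * eta a b) *\<^sub>R e_unit"
proof (cases "a = b")
  case True
  then show ?thesis
    by (simp add: basis_mult sgn_prod_def sgn_pair_def vec_eq_iff)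
      (simp add: scaleR_conv_of_real)
next
  case False
  then have "sym_diff {a} {b} = {a, b}" "sym_diff {b} {a} = {a, b}" by auto
  with False show ?thesis
    by (auto simp: basis_mult sgn_prod_def sgn_pair_def eta_def vec_eq_iff)
qed

lemma basis_insert:
  assumes "\<And>b. b \<in> A \<Longrightarrow> a < b"
  shows "basis (insert a A) = e_gen a \<odot> basis A"
proof -
  have "sym_diff {a} A = insert a A" using assms by auto
  moreover have "sgn_prod {a} A = 1"
    using assms by (fastforce simp: sgn_prod_def sgn_pair_def intro!: prod.neutral)
  ultimately show ?thesis by (simp add: basis_mult)
qed

lemma cl_rev_add: "cl_rev (X + Y) = cl_rev X + cl_rev Y"
  by (simp add: cl_rev_def vec_eq_iff algebra_simps)

lemma cl_rev_scale: "cl_rev (c *s X) = c *s cl_rev X"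
  by (simp add: cl_rev_def vec_eq_iff)

lemma cl_rev_sum: "cl_rev (\<Sum>i\<in>I. f i) = (\<Sum>i\<in>I. cl_rev (f i))"
  by (induction I rule: infinite_finite_induct) (simp_all add: cl_rev_add, simp_all add: cl_rev_def vec_eq_iff)

lemma cl_rev_basis: "cl_rev (basis A) = (-1) ^ (card A choose 2) *s basis A"
  by (simp add: cl_rev_def vec_eq_iff basis_def axis_def)

lemma cl_rev_e_gen: "cl_rev (e_gen a) = e_gen a"
  by (simp add: cl_rev_basis binomial_eq_0)

lemma sign_choose_two_add:
  "(-1::real) ^ ((a + b) choose 2) = (-1) ^ (a choose 2) * (-1) ^ (b choose 2) * (-1) ^ (a * b)"
  by (induction a) (simp_all add: numeral_2_eq_2 power_add mult_ac)

lemma sgn_prod_commute: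
  "sgn_prod B A * (-1) ^ (card A * card B + card (A \<inter> B)) = sgn_prod A B"
proof -
  have s: "sgn_pair b a * ((-1) * (if b = a then -1 else 1)) = sgn_pair a b"
    for a b :: "'a" by (auto simp: sgn_pair_def)
  have "sgn_prod A B = (\<Prod>b\<in>B. \<Prod>a\<in>A. sgn_pair a b)"
    unfolding sgn_prod_def by (rule prod.swap)
  also have "\<dots> = (\<Prod>b\<in>B. \<Prod>a\<in>A. sgn_pair b a * ((-1) * (if b = a then -1 else 1)))"
    by (simp only: s)
  also have "\<dots> = sgn_prod B A * ((-1) ^ (card A * card B) * (\<Prod>b\<in>B. if b \<in> A then -1 else 1))"
    by (simp only: prod.distrib sgn_prod_def)
      (simp add: power_mult prod.delta' del: power_minus_Bit0)
  also have "(\<Prod>b\<in>B. if b \<in> A then -1 else 1) = (-1::real) ^ card (A \<inter> B)"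
    by (simp add: prod.If_cases Int_commute)
  finally show ?thesis by (simp add: power_add)
qed

lemma sign_rev_sym_diff:
  "(-1) ^ (card (sym_diff A B) choose 2) * sgn_prod A B
   = (-1) ^ (card A choose 2) * (-1) ^ (card B choose 2) * sgn_prod B A"
proof -
  define p q c where "p = card (A - B)" and "q = card (B - A)" and "c = card (A \<inter> B)"
  have A: "card A = p + c" and B: "card B = q + c" and D: "card (sym_diff A B) = p + q"
    unfolding p_def q_def c_def
    by (subst card_Un_disjoint[symmetric]; auto intro: arg_cong[where f = card])+
  define f where "f k = (-1::real) ^ (k choose 2)" for k :: nat
  have f: "f (j + k) = f j * f k * (-1) ^ (j * k)" for j k
    by (simp add: f_def sign_choose_two_add)
  have ff: "f k * f k = 1" for k by (simp add: f_def flip: power_add)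
  have e: "even (c * c + c)" by simp
  have "(-1::real) ^ ((p + c) * (q + c) + c)
      = (-1) ^ (p * q) * (-1) ^ (p * c) * (-1) ^ (q * c) * (-1) ^ (c * c + c)"
    by (simp add: algebra_simps power_add)
  also have "(-1::real) ^ (c * c + c) = 1" using e by simp
  finally have s: "(-1::real) ^ ((p + c) * (q + c) + c) = (-1) ^ (p * q) * (-1) ^ (p * c) * (-1) ^ (q * c)"
    by simp
  have m: "(-1::real) ^ k * (-1) ^ k = 1" for k by (simp flip: power_add)
  have "f (p + q) * ((-1) ^ (p * q) * (-1) ^ (p * c) * (-1) ^ (q * c)) = f (p + c) * f (q + c)"
    using ff[of c] m[of "p * q"] by (simp add: f)
  then have "f (p + q) * (-1) ^ ((p + c) * (q + c) + c) = f (p + c) * f (q + c)"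
    by (simp only: s)
  then have "f (p + q) * (sgn_prod B A * (-1) ^ ((p + c) * (q + c) + c)) = f (p + c) * f (q + c) * sgn_prod B A"
    by (metis mult.assoc mult.commute)
  also have "sgn_prod B A * (-1) ^ ((p + c) * (q + c) + c) = sgn_prod A B"
    using sgn_prod_commute[of B A] by (simp only: A B c_def)
  finally show ?thesis by (simp only: f_def A B D)
qed

lemma cl_rev_mult: "cl_rev (X \<odot> Y) = cl_rev Y \<odot> cl_rev X"
proof -
  have b: "cl_rev (basis A \<odot> basis B) = cl_rev (basis B) \<odot> cl_rev (basis A)" for A B :: "'a set"
  proof -
    have "complex_of_real ((-1) ^ (card (sym_diff A B) choose 2) * sgn_prod A B)
        = complex_of_real ((-1) ^ (card A choose 2) * (-1) ^ (card B choose 2) * sgn_prod B A)"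
      by (simp only: sign_rev_sym_diff)
    moreover have "sym_diff B A = sym_diff A B" by blast
    ultimately show ?thesis
      by (simp add: basis_mult cl_rev_scale cl_rev_basis cl_mult_scale_left cl_mult_scale_right mult_ac)
  qed
  have 1: "cl_rev (basis A \<odot> Y) = cl_rev Y \<odot> cl_rev (basis A)" for A :: "'a set"
    by (subst (1 2) cl_expand[of Y])
      (simp only: cl_mult_sum_right cl_mult_sum_left cl_mult_scale_right cl_mult_scale_left
        cl_rev_sum cl_rev_scale b)
  show ?thesis
    by (subst (1 2) cl_expand[of X])
      (simp only: cl_mult_sum_right cl_mult_sum_left cl_mult_scale_right cl_mult_scale_left
        cl_rev_sum cl_rev_scale 1)
qed


subsection \<open>Derivatives and smoothness\<close>

definition pd :: "'n::finite \<Rightarrow> ('n pt \<Rightarrow> 'b::real_normed_vector) \<Rightarrow> 'n pt \<Rightarrow> 'b" where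
  "pd \<mu> f x = frechet_derivative f (at x) (axis \<mu> 1)"

primrec C_k :: "nat \<Rightarrow> ('n::finite pt \<Rightarrow> 'b::real_normed_vector) \<Rightarrow> bool" where
  "C_k 0 f \<longleftrightarrow> continuous_on UNIV f"
| "C_k (Suc k) f \<longleftrightarrow> f differentiable_on UNIV \<and> (\<forall>\<mu>. C_k k (pd \<mu> f))"

definition smooth :: "('n::finite pt \<Rightarrow> 'b::real_normed_vector) \<Rightarrow> bool" where
  "smooth f \<longleftrightarrow> (\<forall>k. C_k k f)"

text \<open>On a set with boundary, the derivative is taken within the set, i.e. one-sided.\<close>

definition C1_on :: "'a::real_normed_vector set \<Rightarrow> ('a \<Rightarrow> 'b::real_normed_vector) \<Rightarrow> bool" where
  "C1_on S f \<longleftrightarrow> (\<exists>f' :: 'a \<Rightarrow> 'a \<Rightarrow>\<^sub>L 'b.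
     (\<forall>x\<in>S. (f has_derivative blinfun_apply (f' x)) (at x within S)) \<and> continuous_on S f')"


subsection \<open>Tetrads and genforms\<close>

text \<open>\<open>y \<mu> a x\<close> stands for $y^\mu_a(x)$.\<close>

definition smooth_tetrad :: "('n::{finite,linorder} \<Rightarrow> 'n \<Rightarrow> 'n pt \<Rightarrow> real) \<Rightarrow> bool" where
  "smooth_tetrad y \<longleftrightarrow> (\<forall>\<mu> a. smooth (y \<mu> a)) \<and>
     (\<forall>x \<mu> \<nu>. (\<Sum>a\<in>UNIV. \<Sum>b\<in>UNIV. y \<mu> a x * y \<nu> b x * eta a b) = eta \<mu> \<nu>)"

definition genvector ::
  "('n::{finite,linorder} \<Rightarrow> 'n \<Rightarrow> 'n pt \<Rightarrow> real) \<Rightarrow> 'n \<Rightarrow> 'n pt \<Rightarrow> 'n cl" where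
  "genvector y \<mu> x = (\<Sum>a\<in>UNIV. y \<mu> a x *\<^sub>R e_gen a)"

text \<open>
  A genform is a function of $x$ with values in the complexified Clifford algebra. Since a genform
  may be considered on a part of space only, the sets below depend on its domain \<open>D\<close>.
\<close>

type_synonym 'n genform = "'n pt \<Rightarrow> 'n cl"

definition hermitian_idempotent :: "'n::{finite,linorder} genform \<Rightarrow> bool" where
  "hermitian_idempotent t \<longleftrightarrow>
     (\<forall>x. t x \<odot> t x = t x) \<and> (\<forall>x. cl_dagger (t x) = t x) \<and>
     t differentiable_on UNIV \<and> (\<forall>\<mu> x. pd \<mu> t x = 0)"

definition I_set :: "'n::{finite,linorder} pt set \<Rightarrow> 'n genform \<Rightarrow> 'n genform set" where
  "I_set D t = {U. \<forall>x\<in>D. U x = U x \<odot> t x}"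

definition K_set :: "'n::{finite,linorder} pt set \<Rightarrow> 'n genform \<Rightarrow> 'n genform set" where
  "K_set D t = {U \<in> I_set D t. \<forall>x\<in>D. U x = t x \<odot> U x}"

definition L_set :: "'n::{finite,linorder} pt set \<Rightarrow> 'n genform \<Rightarrow> 'n genform set" where
  "L_set D t = {U \<in> K_set D t. \<forall>x\<in>D. cl_dagger (U x) = - U x}"


subsection \<open>The Cauchy problems\<close>

definition half_space :: "'n::{finite,linorder} pt set" where
  "half_space = {x. x $ i1 \<ge> 0}"

text \<open>
  Initial data $\psi_0(x^2,\dots,x^n)$ are genforms that do not depend on $x^1$; their support is
  the one in the hyperplane $x^1 = 0$.
\<close>

definition initial_data :: "'n::{finite,linorder} genform \<Rightarrow> bool" where
  "initial_data \<psi>0 \<longleftrightarrow>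
     (\<forall>x x'. (\<forall>\<mu>. \<mu> \<noteq> i1 \<longrightarrow> x $ \<mu> = x' $ \<mu>) \<longrightarrow> \<psi>0 x = \<psi>0 x') \<and>
     smooth \<psi>0 \<and> compact (closure {x. x $ i1 = 0 \<and> \<psi>0 x \<noteq> 0})"

definition dirac_op ::
  "('n::{finite,linorder} \<Rightarrow> 'n \<Rightarrow> 'n pt \<Rightarrow> real) \<Rightarrow> ('n \<Rightarrow> 'n genform) \<Rightarrow> real \<Rightarrow> 'n genform \<Rightarrow> 'n genform" where
  "dirac_op y A m \<psi> x =
     (\<Sum>\<mu>\<in>UNIV. genvector y \<mu> x \<odot> (pd \<mu> \<psi> x + \<psi> x \<odot> A \<mu> x)) + (\<i> * of_real m) *s \<psi> x"

definition solves_P2 ::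
  "('n::{finite,linorder} \<Rightarrow> 'n \<Rightarrow> 'n pt \<Rightarrow> real) \<Rightarrow> ('n \<Rightarrow> 'n genform) \<Rightarrow> real \<Rightarrow> 'n genform \<Rightarrow>
   'n genform \<Rightarrow> bool" where
  "solves_P2 y A m \<psi>0 \<Psi> \<longleftrightarrow>
     C1_on half_space \<Psi> \<and>
     (\<forall>x. x $ i1 > 0 \<longrightarrow> dirac_op y A m \<Psi> x = 0) \<and>
     (\<forall>x. x $ i1 = 0 \<longrightarrow> \<Psi> x = \<psi>0 x)"

definition solves_P1 ::
  "('n::{finite,linorder} \<Rightarrow> 'n \<Rightarrow> 'n pt \<Rightarrow> real) \<Rightarrow> 'n genform \<Rightarrow> ('n \<Rightarrow> 'n genform) \<Rightarrow> real \<Rightarrow> 'n genform \<Rightarrow>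
   'n genform \<Rightarrow> bool" where
  "solves_P1 y t A m \<psi>0 \<psi> \<longleftrightarrow>
     \<psi> \<in> I_set half_space t \<and>
     C1_on half_space \<psi> \<and>
     (\<forall>x. x $ i1 > 0 \<longrightarrow> dirac_op y A m \<psi> x = 0) \<and>
     (\<forall>x. x $ i1 = 0 \<longrightarrow> \<psi> x = \<psi>0 x)"

end

theory Submission
  imports Defs
begin

text \<open>
  Since $t$ is constant and $A_\mu = A_\mu t$, a solution $\Psi$ of (P2) gives
  $\Phi = \Psi (e - t)$ that solves the free equation $h^\mu \partial_\mu \Phi + i m \Phi = 0$ with
  zero initial data, and $\Psi \in I(t)$ means $\Phi = 0$. This is an energy estimate with finite
  propagation speed. Left multiplication by $e^1 e^a$ is self-adjoint for the coefficient inner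
  product, so $J^\mu = \Phi \bullet (e^1 h^\mu \Phi)$ has a divergence that contains no derivative
  of $\Phi$, and $\xi_\mu J^\mu$ is positive for each future timelike covector $\xi$ if $y^1_1 > 0$;
  if $y^1_1 < 0$, replace $y$ and $m$ by their negatives. To see that $\Phi(p) = 0$, take
  $g(x) = 1 - \alpha x^1 - \beta |x - p|^2$ with $g(p) > 0$ and with $-dg$ future timelike on the
  compact set where $g \ge 0$ and $x^1 \ge 0$. For large $N$, the field $\max(g, 0)^{N+2} J$,
  extended by $0$ to $x^1 < 0$, has nonpositive divergence, negative where $g > 0$ and
  $\Phi \ne 0$, while its divergence integrates to $0$.
\<close>

subsection \<open>The current form\<close>

text \<open>Symmetric difference with {a} is an involution, so exactly one coefficient of
  \<open>X\<close> contributes to each \<open>B\<close>: left multiplication by a generator is a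
  signed permutation of coefficients.\<close>

lemma e_gen_mult_nth:
  "(e_gen a \<odot> X) $ B = of_real (sgn_prod {a} (sym_diff {a} B)) * X $ sym_diff {a} B"
proof -
  have *: "B = sym_diff {a} C \<longleftrightarrow> C = sym_diff {a} B" for C by blast
  have nth: "basis A $ B = (if B = A then 1 else 0)" for A :: "'a set"
    by (simp add: basis_def axis_def)
  have "(e_gen a \<odot> X) $ B = (\<Sum>C\<in>UNIV. (X $ C *s (e_gen a \<odot> basis C)) $ B)"
    by (subst cl_expand[of X]) (simp add: cl_mult_sum_right cl_mult_scale_right)
  also have "\<dots> = (\<Sum>C\<in>UNIV. if C = sym_diff {a} B
      then of_real (sgn_prod {a} (sym_diff {a} B)) * X $ sym_diff {a} B else 0)"
    by (intro sum.cong) (simp_all only: basis_mult vector_smult_component nth *, simp_all)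
  finally show ?thesis by simp
qed

text \<open>A permutation of coefficients with signs of square one is an isometry for the real inner
  product.\<close>

lemma e_gen_mult_inner [simp]: "(e_gen a \<odot> X) \<bullet> (e_gen a \<odot> Y) = X \<bullet> Y"
proof -
  have *: "(of_real r * z) \<bullet> (of_real r * w) = (r * r) * (z \<bullet> w)" for r and z w :: complex
    by (simp add: inner_complex_def algebra_simps)
  have "(e_gen a \<odot> X) \<bullet> (e_gen a \<odot> Y) = (\<Sum>B\<in>UNIV. X $ sym_diff {a} B \<bullet> Y $ sym_diff {a} B)"
    by (simp add: inner_vec_def e_gen_mult_nth * sgn_prod_square del: of_real_mult)
  also have "\<dots> = (\<Sum>B\<in>UNIV. X $ B \<bullet> Y $ B)"
    by (rule sum.reindex_bij_witness[of _ "sym_diff {a}" "sym_diff {a}"])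
      (auto intro!: arg_cong2[where f = "(\<bullet>)"] arg_cong2[where f = vec_nth])
  finally show ?thesis by (simp add: inner_vec_def)
qed

lemma e_gen_mult_norm [simp]: "norm (e_gen a \<odot> X) = norm X"
  by (simp add: norm_eq_sqrt_inner)

section \<open>Real linearity of the Clifford product and adjoints of the generators\<close>

lemma scaleR_eq_of_real_scale: "r *\<^sub>R (X :: 'n::finite cl) = complex_of_real r *s X"
  by (simp add: vec_eq_iff) (simp add: scaleR_conv_of_real)

lemma cl_mult_scaleR_left: "(r *\<^sub>R X) \<odot> Y = r *\<^sub>R (X \<odot> Y)"
  by (simp add: scaleR_eq_of_real_scale cl_mult_scale_left)

lemma cl_mult_scaleR_right: "X \<odot> (r *\<^sub>R Y) = r *\<^sub>R (X \<odot> Y)"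
  by (simp add: scaleR_eq_of_real_scale cl_mult_scale_right)

lemma cl_mult_minus_right: "X \<odot> (- Y) = - (X \<odot> Y)"
  using cl_mult_scaleR_right[of X "-1" Y] by simp

lemma cl_mult_minus_left: "(- X) \<odot> Y = - (X \<odot> Y)"
  using cl_mult_scaleR_left[of "-1" X Y] by simp

lemma cl_mult_diff_right: "X \<odot> (Y - Z) = X \<odot> Y - X \<odot> Z"
  using cl_mult_add_right[of X Y "- Z"] by (simp add: cl_mult_minus_right)

lemma bounded_linear_cl_mult_right: "bounded_linear (\<lambda>X. X \<odot> Y)"
  by (intro linear_conv_bounded_linear[THEN iffD1] linearI)
    (simp_all add: cl_mult_add_left cl_mult_scaleR_left)

lemma bounded_linear_cl_mult_left: "bounded_linear (\<lambda>Y. X \<odot> Y)"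
  by (intro linear_conv_bounded_linear[THEN iffD1] linearI)
    (simp_all add: cl_mult_add_right cl_mult_scaleR_right)

lemma e_gen_square: "e_gen a \<odot> e_gen a = eta a a *\<^sub>R e_unit"
proof -
  have "2 *\<^sub>R (e_gen a \<odot> e_gen a) = 2 *\<^sub>R (eta a a *\<^sub>R e_unit)"
    using e_gen_anticommute[of a a] by (simp add: scaleR_2)
  then show ?thesis unfolding scaleR_cancel_left by simp
qed

text \<open>Apply the isometry \<open>e_gen a\<close> to both arguments; its square is the scalar
  \<open>eta a a\<close>. Thus e^1 is self-adjoint and the spatial generators are
  skew-adjoint.\<close>

lemma e_gen_adjoint: "(e_gen a \<odot> X) \<bullet> Y = eta a a * (X \<bullet> (e_gen a \<odot> Y))"
proof -
  have "X \<bullet> (e_gen a \<odot> Y) = (e_gen a \<odot> X) \<bullet> (e_gen a \<odot> (e_gen a \<odot> Y))" by simp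
  also have "\<dots> = eta a a * ((e_gen a \<odot> X) \<bullet> Y)"
    by (simp add: e_gen_square cl_mult_scaleR_left flip: cl_mult_assoc)
  finally show ?thesis by (simp add: eta_def)
qed

text \<open>The Dirac current along the frame index \<open>a\<close>, polarized to a real bilinear
  form so that the product rule applies. Contraction with \<open>y \<mu> a x\<close> gives the
  coordinate component J^\<mu>.\<close>

definition current :: "'n::{finite,linorder} \<Rightarrow> 'n cl \<Rightarrow> 'n cl \<Rightarrow> real" where
  "current a X Y = X \<bullet> (e_gen i1 \<odot> (e_gen a \<odot> Y))"

lemma bounded_bilinear_current: "bounded_bilinear (current a)"
  unfolding current_def
  by (intro bounded_bilinear.comp[OF bounded_bilinear_inner] bounded_linear_ident
      bounded_linear_compose[OF bounded_linear_cl_mult_left bounded_linear_cl_mult_left])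

text \<open>For spatial \<open>a\<close>, one sign comes from the skew adjoint and one from
  anticommuting with e^1, and they cancel. Symmetry makes the derivative of
  \<open>current a X X\<close> twice a single term.\<close>

lemma current_commute: "current a X Y = current a Y X"
proof -
  have "current a Y X = (e_gen a \<odot> X) \<bullet> (e_gen i1 \<odot> Y)"
    using e_gen_adjoint[of i1 Y "e_gen a \<odot> X"] by (simp add: current_def eta_def inner_commute)
  also have "\<dots> = eta a a * (X \<bullet> (e_gen a \<odot> (e_gen i1 \<odot> Y)))"
    by (simp add: e_gen_adjoint)
  also have "e_gen a \<odot> (e_gen i1 \<odot> Y) = eta a a *\<^sub>R (e_gen i1 \<odot> (e_gen a \<odot> Y))"
  proof (cases "a = i1")
    case False
    then have "e_gen a \<odot> e_gen i1 = - (e_gen i1 \<odot> e_gen a)"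
      using e_gen_anticommute[of a i1] by (simp add: eta_def add_eq_0_iff)
    then have "e_gen a \<odot> e_gen i1 \<odot> Y = - (e_gen i1 \<odot> e_gen a \<odot> Y)"
      by (simp add: cl_mult_minus_left)
    with False show ?thesis by (simp add: eta_def cl_mult_assoc)
  qed (simp add: eta_def)
  finally show ?thesis by (simp add: current_def eta_def)
qed

lemma abs_current_le: "\<bar>current a X X\<bar> \<le> (norm X)\<^sup>2"
  using Cauchy_Schwarz_ineq2[of X "e_gen i1 \<odot> (e_gen a \<odot> X)"]
  by (simp add: current_def power2_eq_square)

text \<open>Multiplication by \<i> is skew for the real inner product and commutes with the
  self-adjoint e^1, so the expression is its own negative. Hence the mass drops out of the energy
  balance.\<close>

lemma mass_term_inner: "X \<bullet> (e_gen i1 \<odot> ((\<i> * of_real m) *s X)) = 0"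
proof -
  have i: "U \<bullet> (\<i> *s V) = - ((\<i> *s U) \<bullet> V)" for U V :: "'a cl"
    by (simp add: inner_vec_def inner_complex_def sum_negf[symmetric] algebra_simps)
  have "X \<bullet> (e_gen i1 \<odot> (\<i> *s X)) = (e_gen i1 \<odot> X) \<bullet> (\<i> *s X)"
    by (simp add: e_gen_adjoint[of i1] eta_def)
  also have "\<dots> = - ((e_gen i1 \<odot> (\<i> *s X)) \<bullet> X)"
    by (simp only: i cl_mult_scale_right)
  finally have "X \<bullet> (e_gen i1 \<odot> (\<i> *s X)) = 0" by (simp add: inner_commute)
  moreover have "(\<i> * of_real m) *s X = m *\<^sub>R (\<i> *s X)"
    by (simp add: scaleR_eq_of_real_scale mult_ac)
  ultimately show ?thesis by (simp add: cl_mult_scaleR_right)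
qed

text \<open>The spatial part of the vector \<open>\<zeta>\<close> acts as \<open>L2_set \<zeta> (- {i1})\<close> times an isometry, because
  its Clifford square is a scalar.\<close>

lemma current_ge:
  "(\<zeta> i1 - L2_set \<zeta> (- {i1})) * (norm X)\<^sup>2 \<le> (\<Sum>a\<in>UNIV. \<zeta> a * current a X X)"
proof -
  define v where "v = (\<Sum>a\<in>- {i1}. \<zeta> a *\<^sub>R e_gen a)"
  have vX: "v \<odot> Z = (\<Sum>a\<in>- {i1}. \<zeta> a *\<^sub>R (e_gen a \<odot> Z))" for Z
    by (simp add: v_def cl_mult_sum_left cl_mult_scaleR_left)
  \<comment> \<open>Doubling the square and swapping the indices in one copy produces
    anticommutators, which leave only diagonal terms.\<close>
  have "v \<odot> v + v \<odot> v = (\<Sum>a\<in>- {i1}. \<Sum>b\<in>- {i1}. (\<zeta> a * \<zeta> b) *\<^sub>R (e_gen a \<odot> e_gen b))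
      + (\<Sum>a\<in>- {i1}. \<Sum>b\<in>- {i1}. (\<zeta> a * \<zeta> b) *\<^sub>R (e_gen b \<odot> e_gen a))"
  proof (rule arg_cong2[where f = "(+)"])
    show *: "v \<odot> v = (\<Sum>a\<in>- {i1}. \<Sum>b\<in>- {i1}. (\<zeta> a * \<zeta> b) *\<^sub>R (e_gen b \<odot> e_gen a))"
      by (simp add: v_def cl_mult_sum_left cl_mult_sum_right cl_mult_scaleR_left
          cl_mult_scaleR_right scaleR_sum_right)
    also have "\<dots> = (\<Sum>b\<in>- {i1}. \<Sum>a\<in>- {i1}. (\<zeta> b * \<zeta> a) *\<^sub>R (e_gen b \<odot> e_gen a))"
      by (subst sum.swap) (simp only: mult.commute)
    finally show "v \<odot> v = (\<Sum>a\<in>- {i1}. \<Sum>b\<in>- {i1}. (\<zeta> a * \<zeta> b) *\<^sub>R (e_gen a \<odot> e_gen b))" .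
  qed
  also have "\<dots> = (\<Sum>a\<in>- {i1}. \<Sum>b\<in>- {i1}. (\<zeta> a * \<zeta> b * (2 * eta a b)) *\<^sub>R e_unit)"
    unfolding sum.distrib[symmetric] scaleR_add_right[symmetric] e_gen_anticommute
    by (simp only: scaleR_scaleR)
  also have "\<dots> = (\<Sum>a\<in>- {i1}. (- 2 * (\<zeta> a)\<^sup>2) *\<^sub>R e_unit)"
  proof (rule sum.cong[OF refl])
    fix a :: 'a assume a: "a \<in> - {i1}"
    then have "(\<Sum>b\<in>- {i1}. (\<zeta> a * \<zeta> b * (2 * eta a b)) *\<^sub>R (e_unit :: 'a cl))
        = (\<Sum>b\<in>- {i1}. if b = a then (- 2 * (\<zeta> a)\<^sup>2) *\<^sub>R e_unit else 0)"
      by (intro sum.cong) (auto simp: eta_def power2_eq_square)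
    with a show "(\<Sum>b\<in>- {i1}. (\<zeta> a * \<zeta> b * (2 * eta a b)) *\<^sub>R e_unit) = (- 2 * (\<zeta> a)\<^sup>2) *\<^sub>R (e_unit :: 'a cl)"
      by simp
  qed
  also have "\<dots> = (- 2 * (L2_set \<zeta> (- {i1}))\<^sup>2) *\<^sub>R e_unit"
    by (simp add: L2_set_def sum_nonneg sum_distrib_left sum_negf flip: scaleR_sum_left)
  finally have vv: "v \<odot> v = - (L2_set \<zeta> (- {i1}))\<^sup>2 *\<^sub>R e_unit"
    by (simp add: vec_eq_iff scaleR_conv_of_real)
  \<comment> \<open>\<open>v\<close> is skew-adjoint because it contains only spatial generators;
    with \<open>vv\<close> this determines the norm of \<open>v \<odot> X\<close>.\<close>
  have "(v \<odot> X) \<bullet> Y = - (X \<bullet> (v \<odot> Y))" for Y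
    unfolding vX[of X] vX[of Y]
    by (simp only: inner_sum_left inner_sum_right inner_scaleR_left inner_scaleR_right e_gen_adjoint)
      (simp add: eta_def sum_negf)
  then have "(v \<odot> X) \<bullet> (v \<odot> X) = - (X \<bullet> (v \<odot> (v \<odot> X)))" .
  also have "\<dots> = (L2_set \<zeta> (- {i1}))\<^sup>2 * (norm X)\<^sup>2"
    by (simp add: vv cl_mult_minus_left cl_mult_scaleR_left power2_norm_eq_inner flip: cl_mult_assoc)
  finally have "(norm (v \<odot> X))\<^sup>2 = (L2_set \<zeta> (- {i1}) * norm X)\<^sup>2"
    by (simp add: power2_norm_eq_inner power_mult_distrib)
  then have n: "norm (v \<odot> X) = L2_set \<zeta> (- {i1}) * norm X"
    by (simp add: L2_set_nonneg)
  have "(\<Sum>a\<in>UNIV. \<zeta> a * current a X X) = \<zeta> i1 * current i1 X X + (\<Sum>a\<in>- {i1}. \<zeta> a * current a X X)"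
    by (subst sum.remove[of _ i1]) (auto simp: Compl_eq_Diff_UNIV)
  also have "current i1 X X = (norm X)\<^sup>2"
    by (simp add: current_def e_gen_square cl_mult_scaleR_left eta_def power2_norm_eq_inner flip: cl_mult_assoc)
  also have "(\<Sum>a\<in>- {i1}. \<zeta> a * current a X X) = X \<bullet> (e_gen i1 \<odot> (v \<odot> X))"
    by (simp add: vX current_def cl_mult_sum_right cl_mult_scaleR_right inner_sum_right)
  finally have *: "(\<Sum>a\<in>UNIV. \<zeta> a * current a X X) = \<zeta> i1 * (norm X)\<^sup>2 + X \<bullet> (e_gen i1 \<odot> (v \<odot> X))" .
  have "\<bar>X \<bullet> (e_gen i1 \<odot> (v \<odot> X))\<bar> \<le> L2_set \<zeta> (- {i1}) * (norm X)\<^sup>2"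
    using Cauchy_Schwarz_ineq2[of X "e_gen i1 \<odot> (v \<odot> X)"]
    by (simp add: n power2_eq_square mult_ac)
  then show ?thesis unfolding * by (simp add: left_diff_distrib)
qed

subsection \<open>Timelike covectors\<close>

definition mink :: "('n::{finite,linorder} \<Rightarrow> real) \<Rightarrow> ('n \<Rightarrow> real) \<Rightarrow> real" where
  "mink u v = u i1 * v i1 - (\<Sum>a\<in>- {i1}. u a * v a)"

lemma mink_eq_sum_eta: "(\<Sum>a\<in>UNIV. \<Sum>b\<in>UNIV. u a * v b * eta a b) = mink u v"
proof -
  have "(\<Sum>b\<in>UNIV. u a * v b * eta a b) = u a * v a * eta a a" for a
    by (subst sum.remove[of _ a]) (auto simp: eta_def intro!: sum.neutral)
  then show ?thesis
    by (simp add: mink_def) (subst sum.remove[of _ i1], auto simp: eta_def Compl_eq_Diff_UNIV sum_negf)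
qed

lemma mink_self: "mink v v = (v i1)\<^sup>2 - (L2_set v (- {i1}))\<^sup>2"
  by (simp add: mink_def L2_set_def power2_eq_square sum_nonneg)

lemma mink_sum_left: "mink (\<lambda>a. \<Sum>\<mu>\<in>M. \<xi> \<mu> * y \<mu> a) v = (\<Sum>\<mu>\<in>M. \<xi> \<mu> * mink (y \<mu>) v)"
  unfolding mink_def right_diff_distrib sum_subtractf sum_distrib_left sum_distrib_right
  by (subst (2) sum.swap) (simp add: mult_ac)

lemma mink_commute: "mink u v = mink v u"
  by (simp add: mink_def mult.commute)

text \<open>A timelike \<open>v\<close> lies in the future or in the past cone; by Cauchy-Schwarz
  for the spatial parts, a positive product with the future timelike \<open>u\<close> excludes the
  past. The conclusion makes the coefficient in \<open>current_ge\<close> positive.\<close>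

lemma timelike_future:
  assumes u: "mink u u > 0" "u i1 > 0" and v: "mink v v > 0" and uv: "mink u v > 0"
  shows "v i1 > L2_set v (- {i1})"
proof -
  let ?l = "\<lambda>f. L2_set f (- {i1})"
  have lu: "?l u < u i1" and lv: "?l v < \<bar>v i1\<bar>"
    using u v by (simp_all add: mink_self power2_less_imp_less)
  have "- (\<Sum>a\<in>- {i1}. u a * v a) \<le> (\<Sum>a\<in>- {i1}. \<bar>u a\<bar> * \<bar>v a\<bar>)"
    by (simp add: abs_mult[symmetric] flip: sum_negf) (intro sum_mono, simp)
  also have "\<dots> \<le> ?l u * ?l v" by (rule L2_set_mult_ineq)
  also have "\<dots> \<le> u i1 * ?l v" using lu by (intro mult_right_mono) (auto simp: L2_set_nonneg)
  finally have "0 < u i1 * (v i1 + ?l v)"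
    using uv by (simp add: mink_def distrib_left)
  then have "v i1 + ?l v > 0" using u(2) by (simp add: zero_less_mult_iff)
  with lv show ?thesis by linarith
qed

subsection \<open>Calculus\<close>

text \<open>The difference quotient is at most C |z - x|. This settles differentiability at the two
  kinks of the argument: the hyperplane x^1 = 0 and the origin of \<open>max 0 s\<close>.\<close>

lemma has_derivative_zero_of_quadratic_bound:
  fixes f :: "'a::real_normed_vector \<Rightarrow> 'b::real_normed_vector"
  assumes "f x = 0" "eventually (\<lambda>z. norm (f z) \<le> C * (norm (z - x))\<^sup>2) (at x)"
  shows "(f has_derivative (\<lambda>_. 0)) (at x)"
proof -
  have "((\<lambda>z. norm (f z) / norm (z - x)) \<longlongrightarrow> 0) (at x)"
  proof (rule Lim_null_comparison)
    have "eventually (\<lambda>z. z \<noteq> x) (at x)" by (simp add: eventually_at_filter)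
    with assms(2) show "eventually (\<lambda>z. norm (norm (f z) / norm (z - x)) \<le> C * norm (z - x)) (at x)"
      by eventually_elim (simp add: divide_simps power2_eq_square mult_ac)
    have "((\<lambda>z. C * norm (z - x)) \<longlongrightarrow> C * norm (x - x)) (at x)"
      by (intro tendsto_intros)
    then show "((\<lambda>z. C * norm (z - x)) \<longlongrightarrow> 0) (at x)" by simp
  qed
  then show ?thesis
    by (simp add: has_derivative_iff_norm assms(1))
qed

text \<open>The difference quotients have integral zero by translation invariance, and they are dominated by
  a multiple of an indicator function.\<close>

lemma integral_directional_derivative_eq_0:
  fixes V :: "'a::euclidean_space \<Rightarrow> real"
  assumes d: "\<And>x. (V has_derivative V' x) (at x)"
    and b: "\<And>x. \<bar>V' x e\<bar> \<le> C" and s: "\<And>x. x \<notin> cball p R \<Longrightarrow> V x = 0"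
  shows "integrable lborel (\<lambda>x. V' x e)" and "integral\<^sup>L lborel (\<lambda>x. V' x e) = 0"
proof -
  define h where "h k = 1 / real (Suc k)" for k
  define Q where "Q k x = (V (x + h k *\<^sub>R e) - V x) / h k" for k x
  have h: "h k > 0" "h k \<le> 1" for k by (simp_all add: h_def)
  have contV: "continuous_on UNIV V"
    using has_derivative_continuous[OF d] by (simp add: continuous_at_imp_continuous_on)
  have mV [measurable]: "V \<in> borel_measurable borel"
    using contV by (rule borel_measurable_continuous_onI)
  have intV: "integrable lborel V"
  proof -
    have "set_integrable lborel (cball p R) V"
      unfolding set_integrable_def
      by (rule borel_integrable_compact) (auto intro: continuous_on_subset[OF contV])
    moreover have "(\<lambda>x. indicator (cball p R) x *\<^sub>R V x) = V"
      using s by (auto simp: indicator_def fun_eq_iff simp del: mem_cball)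
    ultimately show ?thesis by (simp add: set_integrable_def)
  qed
  have line: "((\<lambda>r. V (x + r *\<^sub>R e)) has_real_derivative V' (x + r *\<^sub>R e) e) (at r)" for x r
  proof -
    have "((\<lambda>r. V (x + r *\<^sub>R e)) has_derivative (\<lambda>r'. V' (x + r *\<^sub>R e) (r' *\<^sub>R e))) (at r)"
      by (rule has_derivative_compose[OF _ d]) (auto intro!: derivative_eq_intros)
    then show ?thesis
      using linear_scale[OF has_derivative_linear[OF d]]
      by (simp add: has_field_derivative_def mult_commute_abs)
  qed
  have lim: "(\<lambda>k. Q k x) \<longlonglongrightarrow> V' x e" for x
  proof -
    have "((\<lambda>r. (V (x + r *\<^sub>R e) - V x) / r) \<longlongrightarrow> V' x e) (at 0)"
      using line[of x 0] by (simp add: DERIV_def)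
    moreover have "filterlim h (at 0) sequentially"
      unfolding filterlim_at using h(1) LIMSEQ_inverse_real_of_nat
      by (auto simp: h_def[abs_def] inverse_eq_divide intro!: always_eventually)
    ultimately show ?thesis
      unfolding Q_def by (rule filterlim_compose)
  qed
  have C: "C \<ge> 0" using b[of 0] by linarith
  \<comment> \<open>Inside the ball the mean value theorem bounds the quotient by \<open>C\<close>.
    Outside it both evaluation points miss \<open>cball p R\<close>, since the step length
    \<open>h k\<close> is at most 1.\<close>
  have bound: "norm (Q k x) \<le> C * indicator (cball p (R + norm e)) x" for k x
  proof (cases "x \<in> cball p (R + norm e)")
    case True
    obtain z where "V (x + h k *\<^sub>R e) - V (x + 0 *\<^sub>R e) = (h k - 0) * V' (x + z *\<^sub>R e) e"
      using MVT2[OF h(1)[of k], of "\<lambda>r. V (x + r *\<^sub>R e)" "\<lambda>r. V' (x + r *\<^sub>R e) e"] line by blast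
    then have "Q k x = V' (x + z *\<^sub>R e) e" using h(1)[of k] by (simp add: Q_def)
    then show ?thesis using True b by simp
  next
    case False
    have "norm (h k *\<^sub>R e) \<le> norm e" using h[of k] by (simp add: mult_left_le_one_le)
    moreover have "dist p x \<le> dist p (x + h k *\<^sub>R e) + norm (h k *\<^sub>R e)"
      using dist_triangle[of p x "x + h k *\<^sub>R e"] by (simp add: dist_norm)
    moreover have "R + norm e < dist p x" using False by simp
    ultimately have "x \<notin> cball p R" "x + h k *\<^sub>R e \<notin> cball p R"
      unfolding mem_cball using norm_ge_zero[of e] by linarith+
    then show ?thesis by (simp add: Q_def s indicator_def C)
  qed
  have dom: "integrable lborel (\<lambda>x. C * indicator (cball p (R + norm e)) x :: real)"
    by (intro integrable_mult_right integrable_real_indicator) (use emeasure_bounded_finite[OF bounded_cball[of p "R + norm e"]] in auto)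
  have mQ: "Q k \<in> borel_measurable lborel" for k
    unfolding Q_def by measurable
  \<comment> \<open>Measurability of the derivative comes from its being a pointwise limit of
    measurable quotients.\<close>
  have mV': "(\<lambda>x. V' x e) \<in> borel_measurable lborel"
    by (rule borel_measurable_LIMSEQ_metric[OF mQ lim])
  have Q0: "integral\<^sup>L lborel (Q k) = 0" for k
  proof -
    have 1: "integral\<^sup>L lborel (\<lambda>x. V (h k *\<^sub>R e + x)) = integral\<^sup>L lborel V"
      by (subst (2) lborel_distr_plus[symmetric, of "h k *\<^sub>R e"]) (simp add: integral_distr)
    have 2: "integrable lborel (\<lambda>x. V (h k *\<^sub>R e + x))"
      using intV by (subst (asm) lborel_distr_plus[symmetric, of "h k *\<^sub>R e"]) (simp add: integrable_distr_eq)
    show ?thesis unfolding Q_def using 1 2 intV by (simp add: add.commute)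
  qed
  note dct = mV' mQ dom AE_I2[OF lim] AE_I2[OF bound]
  show "integrable lborel (\<lambda>x. V' x e)" by (rule integrable_dominated_convergence[OF dct])
  show "integral\<^sup>L lborel (\<lambda>x. V' x e) = 0"
    using integral_dominated_convergence[OF dct] by (simp add: Q0 LIMSEQ_const_iff)
qed

text \<open>The set where \<open>G\<close> is nonzero is open and null, hence empty.\<close>

lemma continuous_AE_eq_0:
  fixes G :: "'a::euclidean_space \<Rightarrow> real"
  assumes "continuous_on UNIV G" "AE x in lborel. G x = 0"
  shows "G x = 0"
proof (rule ccontr)
  assume "G x \<noteq> 0"
  have o: "open {x. G x \<noteq> 0}"
    using assms(1) by (intro open_Collect_neq continuous_on_const)
  have "{x. G x \<noteq> 0} \<in> null_sets lborel"
    using assms(2) o by (subst AE_iff_null_sets) auto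
  then have "negligible {x. G x \<noteq> 0}"
    by (simp add: negligible_iff_null_sets null_sets_completionI)
  with o \<open>G x \<noteq> 0\<close> show False using open_not_negligible by blast
qed

section \<open>Smooth functions, the half-space, extension by zero and truncation\<close>

lemma smooth_imp:
  assumes "smooth f"
  shows "(f has_derivative frechet_derivative f (at x)) (at x)"
    and "continuous_on UNIV f" and "continuous_on UNIV (pd \<mu> f)"
proof -
  have "C_k 0 f" "C_k (Suc 0) f" using assms by (auto simp: smooth_def)
  then show "continuous_on UNIV f" "continuous_on UNIV (pd \<mu> f)" by auto
  show "(f has_derivative frechet_derivative f (at x)) (at x)"
    using \<open>C_k (Suc 0) f\<close> by (simp add: differentiable_on_def frechet_derivative_works)
qed

lemma at_within_half_space:
  assumes "x $ i1 > 0" shows "at x within half_space = at x"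
  by (rule at_within_open_subset[of x "{x. x $ i1 > 0}"])
    (use assms in \<open>auto simp: half_space_def intro!: open_Collect_less continuous_intros\<close>)

lemma closed_half_space: "closed half_space"
  unfolding half_space_def by (intro closed_Collect_le continuous_intros)

text \<open>The zero extension of \<open>\<Phi>\<close> has a kink at $x^1 = 0$, but quadratic expressions in it do not.\<close>

lemma zero_extension_quadratic_has_derivative:
  fixes \<Phi> :: "'n::{finite,linorder} pt \<Rightarrow> 'b::real_normed_vector"
    and B :: "'b \<Rightarrow> 'b \<Rightarrow> 'c::real_normed_vector"
  assumes B: "bounded_bilinear B" "\<And>X Y. B X Y = B Y X"
    and d: "\<And>x. x \<in> half_space \<Longrightarrow> (\<Phi> has_derivative \<Phi>' x) (at x within half_space)"
    and z: "\<And>x. x $ i1 = 0 \<Longrightarrow> \<Phi> x = 0"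
    and F: "F = (\<lambda>x. if x $ i1 > 0 then \<Phi> x else 0)"
  shows "((\<lambda>x. B (F x) (F x)) has_derivative (\<lambda>h. 2 *\<^sub>R B (F x) (\<Phi>' x h))) (at x)"
proof -
  interpret B: bounded_bilinear B by (rule B)
  consider "x $ i1 > 0" | "x $ i1 < 0" | "x $ i1 = 0" by linarith
  then show ?thesis
  proof cases
    case 1
    then have "(\<Phi> has_derivative \<Phi>' x) (at x)"
      using d[of x] by (simp add: at_within_half_space) (simp add: half_space_def)
    from B.FDERIV[OF this this]
    have "((\<lambda>x. B (\<Phi> x) (\<Phi> x)) has_derivative (\<lambda>h. 2 *\<^sub>R B (F x) (\<Phi>' x h))) (at x)"
      using 1 B(2) by (simp add: F scaleR_2)
    then show ?thesis
      by (rule has_derivative_transform_within_open[where s = "{x. x $ i1 > 0}"])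
        (use 1 in \<open>auto simp: F intro!: open_Collect_less continuous_intros\<close>)
  next
    case 2
    then have "(\<lambda>h. 2 *\<^sub>R B (F x) (\<Phi>' x h)) = (\<lambda>_. 0)" by (simp add: F B.zero_left)
    moreover have "((\<lambda>x. B (F x) (F x)) has_derivative (\<lambda>_. 0)) (at x)"
      by (rule has_derivative_transform_within_open[OF has_derivative_const[of 0],
            where s = "{x. x $ i1 < 0}"])
        (use 2 in \<open>auto simp: F B.zero_left intro!: open_Collect_less continuous_intros\<close>)
    ultimately show ?thesis by simp
  next
    case 3
    then have x: "x \<in> half_space" and Fx: "F x = 0" by (simp_all add: half_space_def F)
    have bl: "bounded_linear (\<Phi>' x)" using d[OF x] by (rule has_derivative_bounded_linear)
    obtain C where C: "\<And>h. norm (\<Phi>' x h) \<le> norm h * C"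
      using bounded_linear.bounded[OF bl] by blast
    obtain M where M: "M > 0" "\<And>X Y. norm (B X Y) \<le> norm X * norm Y * M"
      using B.pos_bounded by blast
    \<comment> \<open>Since \<Phi> vanishes at \<open>x\<close>, one-sided differentiability gives
      at most linear growth, with constant \<open>C + 1\<close>; the bilinear form then grows at
      most quadratically.\<close>
    have "eventually (\<lambda>z. norm (\<Phi> z - \<Phi> x - \<Phi>' x (z - x)) / norm (z - x) < 1) (at x within half_space)"
      using d[OF x] by (intro order_tendstoD[where a = 1 and y = 0]) (simp_all add: has_derivative_iff_norm)
    then have "eventually (\<lambda>z. z \<in> half_space \<longrightarrow> norm (\<Phi> z) \<le> (C + 1) * norm (z - x)) (at x)"
      unfolding eventually_at_filter
    proof (eventually_elim, intro impI)
      fix u assume *: "u \<noteq> x \<longrightarrow> u \<in> half_space \<longrightarrow> norm (\<Phi> u - \<Phi> x - \<Phi>' x (u - x)) / norm (u - x) < 1"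
        and u: "u \<noteq> x" "u \<in> half_space"
      then have "norm (\<Phi> u - \<Phi>' x (u - x)) < norm (u - x)"
        using z[OF 3] by (simp add: divide_simps)
      moreover have "norm (\<Phi> u) \<le> norm (\<Phi> u - \<Phi>' x (u - x)) + norm (\<Phi>' x (u - x))"
        by (metis norm_triangle_sub add.commute)
      ultimately show "norm (\<Phi> u) \<le> (C + 1) * norm (u - x)"
        using C[of "u - x"] by (simp add: algebra_simps)
    qed
    then have "eventually (\<lambda>z. norm (B (F z) (F z)) \<le> M * (C + 1)\<^sup>2 * (norm (z - x))\<^sup>2) (at x)"
    proof eventually_elim
      case (elim u)
      show ?case
      proof (cases "u $ i1 > 0")
        case True
        with elim have "norm (F u) \<le> (C + 1) * norm (u - x)" by (simp add: F half_space_def)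
        then have "norm (F u) * norm (F u) \<le> ((C + 1) * norm (u - x)) * ((C + 1) * norm (u - x))"
          by (intro mult_mono) (auto intro: order_trans[OF norm_ge_zero])
        with M(1) have "norm (F u) * norm (F u) * M \<le> M * (C + 1)\<^sup>2 * (norm (u - x))\<^sup>2"
          by (simp add: power2_eq_square mult_ac)
        with M(2)[of "F u" "F u"] show ?thesis by linarith
      next
        case False
        then show ?thesis using M(1) by (simp add: F B.zero_left)
      qed
    qed
    then show ?thesis
      using has_derivative_zero_of_quadratic_bound[of "\<lambda>x. B (F x) (F x)" x] Fx by (simp add: B.zero_left)
  qed
qed

text \<open>Two continuous pieces on closed half-spaces are glued; they overlap only in x^1 = 0,
  where both vanish.\<close>

lemma zero_extension_continuous:
  fixes \<Phi> :: "'n::{finite,linorder} pt \<Rightarrow> 'b::real_normed_vector"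
  assumes "continuous_on half_space \<Phi>" "\<And>x. x $ i1 = 0 \<Longrightarrow> \<Phi> x = 0"
  shows "continuous_on UNIV (\<lambda>x. if x $ i1 > 0 then \<Phi> x else 0)"
proof -
  have "continuous_on (half_space \<union> {x. x $ i1 \<le> 0}) (\<lambda>x. if x $ i1 > 0 then \<Phi> x else 0)"
    by (rule continuous_on_cases[OF closed_half_space _ assms(1)])
      (use assms(2) in \<open>auto simp: half_space_def intro!: closed_Collect_le continuous_intros\<close>)
  moreover have "half_space \<union> {x :: 'n pt. x $ i1 \<le> 0} = UNIV" by (auto simp: half_space_def)
  ultimately show ?thesis by simp
qed

text \<open>The exponent is at least two, so near the origin the function is bounded by the square
  and the kink of \<open>max 0 s\<close> disappears.\<close>

lemma DERIV_max_0_power: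
  "((\<lambda>s. max 0 s ^ (N + 2)) has_real_derivative real (N + 2) * max 0 s ^ (N + 1)) (at s)"
proof -
  consider "s > 0" | "s < 0" | "s = 0" by linarith
  then show ?thesis
  proof cases
    case 1
    have "((\<lambda>s. s ^ (N + 2)) has_real_derivative real (N + 2) * max 0 s ^ (N + 1)) (at s)"
      using 1 DERIV_pow[of "N + 2" s UNIV] by simp
    then show ?thesis
      by (rule has_field_derivative_transform_within_open[where S = "{0<..}"]) (use 1 in auto)
  next
    case 2
    have "((\<lambda>s. 0) has_real_derivative real (N + 2) * max 0 s ^ (N + 1)) (at s)"
      using 2 by simp
    then show ?thesis
      by (rule has_field_derivative_transform_within_open[where S = "{..<0}"]) (use 2 in auto)
  next
    case 3
    have "eventually (\<lambda>z. z \<in> ball 0 1) (at (0::real))"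
      by (intro eventually_at_in_open') auto
    then have "eventually (\<lambda>z::real. norm (max 0 z ^ (N + 2)) \<le> 1 * (norm (z - 0))\<^sup>2) (at 0)"
    proof eventually_elim
      case (elim z)
      have "max 0 z ^ (N + 2) \<le> max 0 z ^ 2" by (rule power_decreasing) (use elim in auto)
      also have "\<dots> \<le> (norm (z - 0))\<^sup>2" by (rule power_mono) auto
      finally show ?case by simp
    qed
    from has_derivative_zero_of_quadratic_bound[OF _ this] 3 show ?thesis
      by (simp add: has_field_derivative_def lambda_zero)
  qed
qed

subsection \<open>Uniqueness for the free equation\<close>

text \<open>The rows of \<open>y\<close> are orthonormal for \<open>mink\<close>, so \<zeta> has the
  same Minkowski square as \<xi>, and its product with the future timelike row \<open>y i1\<close>
  is \<open>\<xi> i1\<close>.\<close>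

lemma tetrad_preserves_timelike_future:
  fixes y :: "'n::{finite,linorder} \<Rightarrow> 'n \<Rightarrow> real"
  assumes y: "\<And>\<mu> \<nu>. mink (y \<mu>) (y \<nu>) = eta \<mu> \<nu>" and fut: "y i1 i1 > 0"
    and \<xi>: "mink \<xi> \<xi> > 0" "\<xi> i1 > 0"
  defines "\<zeta> \<equiv> \<lambda>a. \<Sum>\<mu>\<in>UNIV. \<xi> \<mu> * y \<mu> a"
  shows "\<zeta> i1 > L2_set \<zeta> (- {i1})"
proof (rule timelike_future[of "y i1"])
  have \<zeta>y: "mink \<zeta> (y \<nu>) = \<xi> \<nu> * eta \<nu> \<nu>" for \<nu>
  proof -
    have "mink \<zeta> (y \<nu>) = (\<Sum>\<mu>\<in>UNIV. if \<mu> = \<nu> then \<xi> \<nu> * eta \<nu> \<nu> else 0)"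
      unfolding \<zeta>_def mink_sum_left by (rule sum.cong) (auto simp: y eta_def)
    then show ?thesis by simp
  qed
  show "mink (y i1) (y i1) > 0" by (simp add: y eta_def)
  show "mink (y i1) \<zeta> > 0" using \<zeta>y[of i1] \<xi>(2) by (simp add: mink_commute eta_def)
  have "mink \<zeta> \<zeta> = (\<Sum>\<mu>\<in>UNIV. \<xi> \<mu> * mink (y \<mu>) \<zeta>)"
    by (subst (1) \<zeta>_def) (rule mink_sum_left)
  also have "\<dots> = (\<Sum>\<mu>\<in>UNIV. \<Sum>\<nu>\<in>UNIV. \<xi> \<mu> * \<xi> \<nu> * eta \<mu> \<nu>)"
  proof (rule sum.cong[OF refl])
    fix \<mu>
    have "(\<Sum>\<nu>\<in>UNIV. \<xi> \<mu> * \<xi> \<nu> * eta \<mu> \<nu>) = (\<Sum>\<nu>\<in>UNIV. if \<nu> = \<mu> then \<xi> \<mu> * \<xi> \<mu> * eta \<mu> \<mu> else 0)"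
      by (rule sum.cong) (auto simp: eta_def)
    then show "\<xi> \<mu> * mink (y \<mu>) \<zeta> = (\<Sum>\<nu>\<in>UNIV. \<xi> \<mu> * \<xi> \<nu> * eta \<mu> \<nu>)"
      by (simp add: mink_commute[of _ \<zeta>] \<zeta>y)
  qed
  finally show "mink \<zeta> \<zeta> > 0" using \<xi>(1) by (simp add: mink_eq_sum_eta)
qed (rule fut)

lemma smooth_tetrad_mink:
  "smooth_tetrad y \<Longrightarrow> mink (\<lambda>a. y \<mu> a x) (\<lambda>a. y \<nu> a x) = eta \<mu> \<nu>"
  unfolding smooth_tetrad_def mink_eq_sum_eta by blast

text \<open>This is the inner product of \<open>X\<close> with e^1 times the equation, without the
  vanishing mass term. With partial derivatives as \<open>Z \<mu>\<close>, it removes all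
  derivatives of the field from the divergence of the current.\<close>

lemma dirac_current_divergence:
  assumes "(\<Sum>\<mu>\<in>UNIV. genvector y \<mu> x \<odot> Z \<mu>) + (\<i> * of_real m) *s X = 0"
  shows "(\<Sum>\<mu>\<in>UNIV. \<Sum>a\<in>UNIV. y \<mu> a x * current a X (Z \<mu>)) = 0"
proof -
  have "(\<Sum>\<mu>\<in>UNIV. \<Sum>a\<in>UNIV. y \<mu> a x * current a X (Z \<mu>))
      = X \<bullet> (e_gen i1 \<odot> (\<Sum>\<mu>\<in>UNIV. genvector y \<mu> x \<odot> Z \<mu>))"
    by (simp add: genvector_def current_def cl_mult_sum_left cl_mult_sum_right
        cl_mult_scaleR_left cl_mult_scaleR_right inner_sum_right)
  also have "(\<Sum>\<mu>\<in>UNIV. genvector y \<mu> x \<odot> Z \<mu>) = - ((\<i> * of_real m) *s X)"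
    using assms by (simp add: add_eq_0_iff2)
  finally show ?thesis
    by (simp add: cl_mult_minus_right mass_term_inner)
qed

text \<open>\<open>\<Phi>'\<close> is explicit because the derivative at the boundary is one-sided;
  its continuity up to x^1 = 0 bounds the divergence on a compact region that reaches the
  boundary.\<close>

lemma free_dirac_unique_future:
  fixes y :: "'n::{finite,linorder} \<Rightarrow> 'n \<Rightarrow> 'n pt \<Rightarrow> real"
    and \<Phi>' :: "'n pt \<Rightarrow> 'n pt \<Rightarrow>\<^sub>L 'n cl"
  assumes y: "smooth_tetrad y" and fut: "\<And>x. y i1 i1 x > 0"
    and d: "\<And>x. x \<in> half_space \<Longrightarrow> (\<Phi> has_derivative \<Phi>' x) (at x within half_space)"
    and c': "continuous_on half_space \<Phi>'"
    and eq: "\<And>x. x $ i1 > 0 \<Longrightarrow>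
      (\<Sum>\<mu>\<in>UNIV. genvector y \<mu> x \<odot> \<Phi>' x (axis \<mu> 1)) + (\<i> * of_real m) *s \<Phi> x = 0"
    and z: "\<And>x. x $ i1 = 0 \<Longrightarrow> \<Phi> x = 0"
    and p: "p $ i1 > 0"
  shows "\<Phi> p = 0"
proof -
  \<comment> \<open>With these values \<open>g p = 1/2\<close>. On \<open>K\<close> the \<beta>-term
    of \<open>g\<close> is at most 1, so |x - p| \<le> 4/\<alpha>, and its gradient 2\<beta>(x - p)
    has length at most \<alpha>/2.\<close>
  define \<alpha> \<beta> where "\<alpha> = 1 / (2 * p $ i1)" and "\<beta> = \<alpha>\<^sup>2 / 16"
  have \<alpha>: "\<alpha> > 0" "\<alpha> * p $ i1 = 1/2" and \<beta>: "\<beta> > 0"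
    using p by (simp_all add: \<alpha>_def \<beta>_def)
  define g where "g x = 1 - \<alpha> * x $ i1 - \<beta> * (norm (x - p))\<^sup>2" for x
  \<comment> \<open>\<xi> is the covector -dg, and \<zeta> consists of its frame components.\<close>
  define \<xi> where "\<xi> x \<mu> = \<alpha> * (if \<mu> = i1 then 1 else 0) + 2 * \<beta> * (x - p) $ \<mu>" for x \<mu>
  define \<zeta> where "\<zeta> x a = (\<Sum>\<mu>\<in>UNIV. \<xi> x \<mu> * y \<mu> a x)" for x a
  define K where "K = {x \<in> half_space. 0 \<le> g x}"
  have sm: "smooth (y \<mu> a)" for \<mu> a using y by (simp add: smooth_tetrad_def)
  note cy = continuous_on_subset[OF smooth_imp(2)[OF sm] subset_UNIV]
    and cpd = continuous_on_subset[OF smooth_imp(3)[OF sm] subset_UNIV]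
  have cg: "continuous_on S g" for S unfolding g_def by (intro continuous_intros)
  have \<Phi>c: "continuous_on half_space \<Phi>"
    using d has_derivative_continuous continuous_on_eq_continuous_within by blast
  have ball: "x \<in> cball p (4 / \<alpha>)" if "x \<in> K" for x
  proof -
    have "0 \<le> \<alpha> * x $ i1" using that \<alpha>(1) by (simp add: K_def half_space_def)
    then have "\<beta> * (norm (x - p))\<^sup>2 \<le> 1" using that by (simp add: K_def g_def)
    then have "(norm (x - p))\<^sup>2 \<le> (4 / \<alpha>)\<^sup>2"
      using \<alpha>(1) by (simp add: \<beta>_def field_simps)
    then show ?thesis using \<alpha>(1) by (simp add: dist_norm norm_minus_commute power2_le_iff_abs_le)
  qed
  have compK: "compact K"
    unfolding compact_eq_bounded_closed
  proof
    show "bounded K" using ball by (intro bounded_subset[OF bounded_cball]) blast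
    have "K = half_space \<inter> {x. 0 \<le> g x}" by (auto simp: K_def)
    then show "closed K"
      using closed_half_space by (auto intro!: closed_Int closed_Collect_le cg continuous_intros)
  qed
  have pK: "p \<in> K" and gp: "g p > 0" using p \<alpha> by (auto simp: K_def half_space_def g_def)
  \<comment> \<open>The time component of \<xi> is at least 15\<alpha>/16, as x^1 \<ge> 0 and
    2\<beta>p^1 = \<alpha>/16, and its spatial length is at most \<alpha>/2. So \<xi> is future
    timelike, and the tetrad carries this over to \<zeta>.\<close>
  have causal: "\<zeta> x i1 - L2_set (\<zeta> x) (- {i1}) > 0" if x: "x \<in> K" for x
  proof -
    have "\<alpha> * (15/16) \<le> \<xi> x i1"
    proof -
      have "0 \<le> \<beta> * x $ i1" using x \<beta> by (simp add: K_def half_space_def)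
      moreover have "\<beta> * p $ i1 = \<alpha> / 32"
        using \<alpha>(2) by (simp add: \<beta>_def power2_eq_square field_simps)
      ultimately show ?thesis by (simp add: \<xi>_def algebra_simps)
    qed
    moreover from less_le_trans[OF _ this] have pos: "\<xi> x i1 > 0" using \<alpha>(1) by simp
    ultimately have "(\<alpha> * (15/16))\<^sup>2 \<le> (\<xi> x i1)\<^sup>2"
      using \<alpha>(1) by (intro power_mono) auto
    moreover have "(L2_set (\<xi> x) (- {i1}))\<^sup>2 \<le> \<alpha>\<^sup>2 / 4"
    proof -
      have "(L2_set (\<xi> x) (- {i1}))\<^sup>2 = (2 * \<beta>)\<^sup>2 * (\<Sum>\<mu>\<in>- {i1}. ((x - p) $ \<mu>)\<^sup>2)"
        by (simp add: L2_set_def \<xi>_def sum_nonneg sum_distrib_left power_mult_distrib)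
      also have "\<dots> \<le> (2 * \<beta>)\<^sup>2 * (norm (x - p))\<^sup>2"
        by (auto simp: norm_vec_def L2_set_def sum_nonneg intro!: mult_left_mono sum_mono2)
      also have "\<dots> \<le> (2 * \<beta>)\<^sup>2 * (4 / \<alpha>)\<^sup>2"
        using ball[OF x] by (intro mult_left_mono power_mono) (auto simp: dist_norm norm_minus_commute)
      also have "\<dots> = \<alpha>\<^sup>2 / 4"
        using \<alpha>(1) by (simp add: \<beta>_def power2_eq_square field_simps)
      finally show ?thesis .
    qed
    moreover have "\<alpha>\<^sup>2 > 0" using \<alpha>(1) by simp
    ultimately have "mink (\<xi> x) (\<xi> x) > 0"
      by (simp add: mink_self power_mult_distrib power2_eq_square)
    from tetrad_preserves_timelike_future[of "\<lambda>\<mu> a. y \<mu> a x" "\<xi> x", OF smooth_tetrad_mink[OF y] fut this pos]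
    show ?thesis by (simp add: \<zeta>_def[abs_def])
  qed
  \<comment> \<open>Compactness turns pointwise positivity into a uniform lower bound
    \<open>c\<close>.\<close>
  have "continuous_on K (\<lambda>x. \<zeta> x i1 - L2_set (\<zeta> x) (- {i1}))"
    unfolding \<zeta>_def \<xi>_def L2_set_def by (intro continuous_intros cy)
  then obtain x0 where "x0 \<in> K" and
    x0: "\<And>x. x \<in> K \<Longrightarrow> \<zeta> x0 i1 - L2_set (\<zeta> x0) (- {i1}) \<le> \<zeta> x i1 - L2_set (\<zeta> x) (- {i1})"
    using continuous_attains_inf[OF compK] pK by blast
  define c where "c = \<zeta> x0 i1 - L2_set (\<zeta> x0) (- {i1})"
  have c: "c > 0" unfolding c_def by (rule causal) fact
  have "continuous_on K (\<lambda>x. \<Sum>\<mu>\<in>UNIV. \<Sum>a\<in>UNIV. \<bar>pd \<mu> (y \<mu> a) x\<bar>)"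
    by (intro continuous_intros cpd)
  then obtain M where M: "\<And>x. x \<in> K \<Longrightarrow> (\<Sum>\<mu>\<in>UNIV. \<Sum>a\<in>UNIV. \<bar>pd \<mu> (y \<mu> a) x\<bar>) \<le> M"
    using continuous_attains_sup[OF compK, of "\<lambda>x. \<Sum>\<mu>\<in>UNIV. \<Sum>a\<in>UNIV. \<bar>pd \<mu> (y \<mu> a) x\<bar>"] pK by blast
  \<comment> \<open>\<open>N\<close> is chosen so that the derivative of the weight dominates the
    derivatives of the tetrad, which \<open>M\<close> bounds.\<close>
  obtain N :: nat where "M / c \<le> real N" using real_arch_simple by blast
  then have N: "M \<le> real N * c" using c by (simp add: field_simps)

  define F where "F = (\<lambda>x. if x $ i1 > 0 then \<Phi> x else 0)"
  define w where "w x = max 0 (g x)" for x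
  \<comment> \<open>The derivative of the weighted current component in direction \<open>h\<close>.
    The field value is a separate argument: \<open>F x\<close> in the integral,
    \<open>\<Phi> x\<close> where continuity on \<open>K\<close> is shown.\<close>
  define D where "D X \<mu> x h = w x ^ (N + 2)
      * (\<Sum>a\<in>UNIV. y \<mu> a x * (2 * current a X (\<Phi>' x h)) + frechet_derivative (y \<mu> a) (at x) h * current a X X)
      + real (N + 2) * w x ^ (N + 1) * (- \<alpha> * h $ i1 - 2 * \<beta> * ((x - p) \<bullet> h)) * (\<Sum>a\<in>UNIV. y \<mu> a x * current a X X)"
    for X \<mu> x h
  have current_0 [simp]: "current a 0 Y = 0" for a and Y :: "'n cl" by (simp add: current_def)
  have Q: "((\<lambda>x. current a (F x) (F x)) has_derivative (\<lambda>h. 2 * current a (F x) (\<Phi>' x h))) (at x)" for a x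
    using zero_extension_quadratic_has_derivative[OF bounded_bilinear_current current_commute d z F_def, of a x]
    by simp
  have gd: "(g has_derivative (\<lambda>h. - \<alpha> * h $ i1 - 2 * \<beta> * ((x - p) \<bullet> h))) (at x)" for x
  proof -
    have "((\<lambda>x. x $ i1) has_derivative (\<lambda>h. h $ i1)) (at x)"
      by (intro bounded_linear_imp_has_derivative bounded_linear_vec_nth)
    then show ?thesis
      unfolding g_def power2_norm_eq_inner
      by (auto intro!: derivative_eq_intros simp: inner_commute algebra_simps)
  qed
  have wd: "((\<lambda>x. w x ^ (N + 2)) has_derivative
      (\<lambda>h. real (N + 2) * w x ^ (N + 1) * (- \<alpha> * h $ i1 - 2 * \<beta> * ((x - p) \<bullet> h)))) (at x)" for x
    using has_derivative_compose[OF gd DERIV_max_0_power[unfolded has_field_derivative_def]]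
    unfolding w_def .
  have Wd: "((\<lambda>x. w x ^ (N + 2) * (\<Sum>a\<in>UNIV. y \<mu> a x * current a (F x) (F x)))
      has_derivative D (F x) \<mu> x) (at x)" for \<mu> x
    unfolding D_def
    by (intro has_derivative_mult has_derivative_sum wd Q smooth_imp(1)[OF sm])
  have D_eq_0: "D (F x) \<mu> x h = 0" if "x \<notin> K \<or> \<not> x $ i1 > 0" for \<mu> x h
    using that by (auto simp: D_def F_def w_def K_def half_space_def)
  have D_bound: "\<exists>C. \<forall>x. \<bar>D (F x) \<mu> x (axis \<mu> 1)\<bar> \<le> C" for \<mu>
  proof -
    \<comment> \<open>A bound for \<Phi> on \<open>K\<close> suffices, as \<open>D (F x)\<close>
      either agrees with \<open>D (\<Phi> x)\<close> there or is zero.\<close>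
    have "continuous_on K (\<lambda>x. D (\<Phi> x) \<mu> x (axis \<mu> 1))"
    proof -
      have KH: "K \<subseteq> half_space" by (auto simp: K_def)
      have \<Phi>': "continuous_on K (\<lambda>x. \<Phi>' x (axis \<mu> 1))"
        by (intro continuous_intros continuous_on_subset[OF c' KH])
      show ?thesis
        unfolding D_def w_def pd_def[symmetric]
        by (intro continuous_intros cg cy cpd \<Phi>' continuous_on_subset[OF \<Phi>c KH]
            bounded_bilinear.continuous_on[OF bounded_bilinear_current])
    qed
    then have "bounded ((\<lambda>x. D (\<Phi> x) \<mu> x (axis \<mu> 1)) ` K)"
      using compK compact_continuous_image compact_imp_bounded by blast
    then obtain C where C: "C > 0" "\<And>x. x \<in> K \<Longrightarrow> \<bar>D (\<Phi> x) \<mu> x (axis \<mu> 1)\<bar> \<le> C"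
      unfolding bounded_pos by auto
    have "\<bar>D (F x) \<mu> x (axis \<mu> 1)\<bar> \<le> C" for x
    proof (cases "x \<in> K \<and> x $ i1 > 0")
      case True
      then have "F x = \<Phi> x" by (simp add: F_def)
      with C(2)[of x] True show ?thesis by simp
    next
      case False
      with D_eq_0[of x \<mu>] C(1) show ?thesis by auto
    qed
    then show ?thesis by blast
  qed
  have supp: "w x ^ (N + 2) * (\<Sum>a\<in>UNIV. y \<mu> a x * current a (F x) (F x)) = 0"
    if "x \<notin> cball p (4 / \<alpha>)" for \<mu> x
  proof -
    have "x \<notin> K" using ball that by blast
    then show ?thesis by (auto simp: F_def w_def K_def half_space_def)
  qed
  have int: "integrable lborel (\<lambda>x. D (F x) \<mu> x (axis \<mu> 1))"
    "integral\<^sup>L lborel (\<lambda>x. D (F x) \<mu> x (axis \<mu> 1)) = 0" for \<mu>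
  proof -
    obtain C where "\<And>x. \<bar>D (F x) \<mu> x (axis \<mu> 1)\<bar> \<le> C" using D_bound[of \<mu>] by blast
    note * = integral_directional_derivative_eq_0[OF Wd this supp]
    show "integrable lborel (\<lambda>x. D (F x) \<mu> x (axis \<mu> 1))" by (rule *)
    show "integral\<^sup>L lborel (\<lambda>x. D (F x) \<mu> x (axis \<mu> 1)) = 0" by (rule *)
  qed
  define dvg where "dvg x = (\<Sum>\<mu>\<in>UNIV. D (F x) \<mu> x (axis \<mu> 1))" for x
  \<comment> \<open>Derivatives of the field cancel by the equation (\<open>T1\<close>), those of
    the tetrad cost at most N c times the squared norm (\<open>T2\<close>), and the weight gains N +
    2 times \<open>c\<close> (\<open>T3\<close>).\<close>
  have dvg: "c * (w x ^ (N + 1) * (norm (F x))\<^sup>2) \<le> - dvg x" for x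
  proof (cases "x \<in> K \<and> x $ i1 > 0")
    case False
    then have "w x = 0 \<or> F x = 0" by (auto simp: F_def w_def K_def half_space_def)
    with False show ?thesis by (auto simp: dvg_def D_eq_0)
  next
    case True
    then have K: "x \<in> K" and Fx: "F x = \<Phi> x" by (simp_all add: F_def)
    let ?q = "\<lambda>a. current a (F x) (F x)" and ?n = "(norm (F x))\<^sup>2"
    have "0 \<le> \<alpha> * x $ i1" "0 \<le> \<beta> * (norm (x - p))\<^sup>2"
      using True \<alpha>(1) \<beta> by simp_all
    then have w: "0 \<le> w x" "w x \<le> 1" by (simp_all add: w_def g_def)
    have ax: "- \<alpha> * axis \<mu> 1 $ i1 - 2 * \<beta> * ((x - p) \<bullet> axis \<mu> 1) = - \<xi> x \<mu>" for \<mu>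
      by (simp add: \<xi>_def inner_axis) (simp add: axis_def)
    have "(\<Sum>\<mu>\<in>UNIV. \<Sum>a\<in>UNIV. y \<mu> a x * current a (F x) (\<Phi>' x (axis \<mu> 1))) = 0"
      unfolding Fx using eq[of x] True by (intro dirac_current_divergence) auto
    moreover have "(\<Sum>\<mu>\<in>UNIV. \<Sum>a\<in>UNIV. y \<mu> a x * (2 * current a (F x) (\<Phi>' x (axis \<mu> 1))))
        = 2 * (\<Sum>\<mu>\<in>UNIV. \<Sum>a\<in>UNIV. y \<mu> a x * current a (F x) (\<Phi>' x (axis \<mu> 1)))"
      unfolding sum_distrib_left by (intro sum.cong refl) simp
    ultimately have T1: "(\<Sum>\<mu>\<in>UNIV. \<Sum>a\<in>UNIV. y \<mu> a x * (2 * current a (F x) (\<Phi>' x (axis \<mu> 1)))) = 0"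
      by simp
    have "(\<Sum>\<mu>\<in>UNIV. \<Sum>a\<in>UNIV. pd \<mu> (y \<mu> a) x * ?q a) \<le> (\<Sum>\<mu>\<in>UNIV. \<Sum>a\<in>UNIV. \<bar>pd \<mu> (y \<mu> a) x\<bar> * ?n)"
    proof (intro sum_mono)
      fix \<mu> a
      have "pd \<mu> (y \<mu> a) x * ?q a \<le> \<bar>pd \<mu> (y \<mu> a) x\<bar> * \<bar>?q a\<bar>" by (simp flip: abs_mult)
      also have "\<dots> \<le> \<bar>pd \<mu> (y \<mu> a) x\<bar> * ?n" by (intro mult_left_mono abs_current_le) simp
      finally show "pd \<mu> (y \<mu> a) x * ?q a \<le> \<bar>pd \<mu> (y \<mu> a) x\<bar> * ?n" .
    qed
    also have "\<dots> \<le> M * ?n"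
      using M[OF K] by (simp add: mult_right_mono flip: sum_distrib_right)
    also have "\<dots> \<le> real N * c * ?n" by (intro mult_right_mono N) simp
    finally have T2: "(\<Sum>\<mu>\<in>UNIV. \<Sum>a\<in>UNIV. pd \<mu> (y \<mu> a) x * ?q a) \<le> real N * c * ?n" .
    have "(\<Sum>\<mu>\<in>UNIV. \<xi> x \<mu> * (\<Sum>a\<in>UNIV. y \<mu> a x * ?q a)) = (\<Sum>a\<in>UNIV. \<zeta> x a * ?q a)"
      unfolding \<zeta>_def sum_distrib_left sum_distrib_right
      by (subst sum.swap) (simp add: mult.assoc)
    also have "\<dots> \<ge> c * ?n"
      using current_ge[of "\<zeta> x" "F x"] mult_right_mono[OF x0[OF K], of ?n] by (simp add: c_def)
    finally have T3: "c * ?n \<le> (\<Sum>\<mu>\<in>UNIV. \<xi> x \<mu> * (\<Sum>a\<in>UNIV. y \<mu> a x * ?q a))" .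
    have "dvg x = w x ^ (N + 2) * (\<Sum>\<mu>\<in>UNIV. \<Sum>a\<in>UNIV. pd \<mu> (y \<mu> a) x * ?q a)
        - real (N + 2) * w x ^ (N + 1) * (\<Sum>\<mu>\<in>UNIV. \<xi> x \<mu> * (\<Sum>a\<in>UNIV. y \<mu> a x * ?q a))"
    proof -
      have "dvg x = (\<Sum>\<mu>\<in>UNIV. w x ^ (N + 2)
          * ((\<Sum>a\<in>UNIV. y \<mu> a x * (2 * current a (F x) (\<Phi>' x (axis \<mu> 1)))) + (\<Sum>a\<in>UNIV. pd \<mu> (y \<mu> a) x * ?q a))
          - real (N + 2) * w x ^ (N + 1) * (\<xi> x \<mu> * (\<Sum>a\<in>UNIV. y \<mu> a x * ?q a)))"
        unfolding dvg_def D_def ax pd_def sum.distrib by (simp only: mult_minus_right mult_minus_left mult.assoc diff_conv_add_uminus sum.distrib)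
      also have "\<dots> = w x ^ (N + 2) * ((\<Sum>\<mu>\<in>UNIV. \<Sum>a\<in>UNIV. y \<mu> a x * (2 * current a (F x) (\<Phi>' x (axis \<mu> 1))))
          + (\<Sum>\<mu>\<in>UNIV. \<Sum>a\<in>UNIV. pd \<mu> (y \<mu> a) x * ?q a))
          - real (N + 2) * w x ^ (N + 1) * (\<Sum>\<mu>\<in>UNIV. \<xi> x \<mu> * (\<Sum>a\<in>UNIV. y \<mu> a x * ?q a))"
        by (simp only: sum_subtractf sum.distrib flip: sum_distrib_left)
      finally show ?thesis unfolding T1 by simp
    qed
    also have "\<dots> \<le> w x ^ (N + 2) * (real N * c * ?n) - real (N + 2) * w x ^ (N + 1) * (c * ?n)"
      using w(1) by (intro diff_mono mult_left_mono T2 T3) auto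
    \<comment> \<open>Since 0 \<le> w \<le> 1, lowering the exponent can only enlarge the term. The
      difference of N + 2 and N then leaves a factor 2, of which one copy is kept.\<close>
    also have "w x ^ (N + 2) * (real N * c * ?n) \<le> w x ^ (N + 1) * (real N * c * ?n)"
      using w c by (intro mult_right_mono power_decreasing) auto
    finally have "dvg x \<le> - (2 * (c * (w x ^ (N + 1) * ?n)))" by (simp add: algebra_simps)
    moreover have "0 \<le> c * (w x ^ (N + 1) * ?n)" using c w(1) by simp
    ultimately show ?thesis by linarith
  qed
  have w0: "0 \<le> w x" for x by (simp add: w_def)
  have idiv: "integrable lborel dvg" "integral\<^sup>L lborel dvg = 0"
    using int by (simp_all add: dvg_def[abs_def])
  have div0: "0 \<le> - dvg x" for x
  proof -
    have "0 \<le> c * (w x ^ (N + 1) * (norm (F x))\<^sup>2)" using c w0[of x] by simp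
    also note dvg[of x]
    finally show ?thesis .
  qed
  \<comment> \<open>A nonnegative function with zero integral vanishes almost everywhere; continuity
    of the weighted energy density then gives its vanishing at \<open>p\<close>, where the weight is
    positive.\<close>
  have "AE x in lborel. - dvg x = 0"
    using integral_nonneg_eq_0_iff_AE[of lborel "\<lambda>x. - dvg x"] idiv div0 by simp
  then have "AE x in lborel. w x ^ (N + 1) * (norm (F x))\<^sup>2 = 0"
  proof eventually_elim
    case (elim x)
    then have "c * (w x ^ (N + 1) * (norm (F x))\<^sup>2) \<le> c * 0" using dvg[of x] by simp
    then have "w x ^ (N + 1) * (norm (F x))\<^sup>2 \<le> 0" using c by (simp only: mult_le_cancel_left_pos)
    moreover have "0 \<le> w x ^ (N + 1) * (norm (F x))\<^sup>2" using w0 by simp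
    ultimately show ?case by linarith
  qed
  moreover have "continuous_on UNIV (\<lambda>x. w x ^ (N + 1) * (norm (F x))\<^sup>2)"
    unfolding w_def F_def by (intro continuous_intros cg zero_extension_continuous[OF \<Phi>c z])
  ultimately have "w p ^ (N + 1) * (norm (F p))\<^sup>2 = 0" by (intro continuous_AE_eq_0)
  then show ?thesis using gp p by (simp add: w_def F_def)
qed


section \<open>Time orientation of the tetrad\<close>

lemma C_k_uminus: "C_k k f \<Longrightarrow> C_k k (\<lambda>x. - f x)"
proof (induction k arbitrary: f)
  case (Suc k)
  then have "((\<lambda>x. - f x) has_derivative (\<lambda>h. - frechet_derivative f (at x) h)) (at x)" for x
    by (auto simp: differentiable_on_def frechet_derivative_works intro!: has_derivative_minus)
  from frechet_derivative_at[OF this] have "pd \<mu> (\<lambda>x. - f x) = (\<lambda>x. - pd \<mu> f x)" for \<mu>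
    by (simp add: pd_def fun_eq_iff)
  moreover have "(\<lambda>x. - f x) differentiable_on UNIV"
    using Suc.prems by (simp add: differentiable_on_def)
  ultimately show ?case using Suc by simp
qed (simp add: continuous_on_minus)

lemma smooth_tetrad_uminus:
  assumes "smooth_tetrad y" shows "smooth_tetrad (\<lambda>\<mu> a x. - y \<mu> a x)"
  using assms by (simp add: smooth_tetrad_def smooth_def C_k_uminus)

text \<open>If y^1_1 vanished somewhere, the row would have nonpositive Minkowski square there
  instead of 1. Continuity on a connected space then fixes its sign.\<close>

lemma smooth_tetrad_time_oriented:
  assumes "smooth_tetrad y"
  shows "(\<forall>x. y i1 i1 x > 0) \<or> (\<forall>x. y i1 i1 x < 0)"
proof (rule ccontr)
  have nz: "y i1 i1 x \<noteq> 0" for x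
  proof
    assume "y i1 i1 x = 0"
    then have "mink (\<lambda>a. y i1 a x) (\<lambda>a. y i1 a x) \<le> 0" by (simp add: mink_self)
    then show False using smooth_tetrad_mink[OF assms, of i1 x i1] by (simp add: eta_def)
  qed
  assume "\<not> ?thesis"
  then obtain x x' where "y i1 i1 x \<le> 0" "0 \<le> y i1 i1 x'" by (auto simp: not_less)
  moreover have "connected (range (y i1 i1))"
  proof (rule connected_continuous_image[OF _ connected_UNIV])
    show "continuous_on UNIV (y i1 i1)"
      using assms by (intro smooth_imp(2)) (simp add: smooth_tetrad_def)
  qed
  ultimately have "0 \<in> range (y i1 i1)"
    by (meson connectedD_interval rangeI)
  with nz show False by (metis rangeE)
qed

text \<open>If y^1_1 is negative, negating \<open>y\<close> and \<open>m\<close> together multiplies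
  the free equation by -1 and makes the tetrad future oriented.\<close>

lemma free_dirac_unique:
  fixes y :: "'n::{finite,linorder} \<Rightarrow> 'n \<Rightarrow> 'n pt \<Rightarrow> real"
  assumes y: "smooth_tetrad y" and \<Phi>: "C1_on half_space \<Phi>"
    and eq: "\<And>x. x $ i1 > 0 \<Longrightarrow> dirac_op y (\<lambda>_ _. 0) m \<Phi> x = 0"
    and z: "\<And>x. x $ i1 = 0 \<Longrightarrow> \<Phi> x = 0"
    and p: "p \<in> half_space"
  shows "\<Phi> p = 0"
proof (cases "p $ i1 = 0")
  case False
  with p have p: "p $ i1 > 0" by (simp add: half_space_def)
  obtain \<Phi>' where d: "\<And>x. x \<in> half_space \<Longrightarrow> (\<Phi> has_derivative blinfun_apply (\<Phi>' x)) (at x within half_space)"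
    and c': "continuous_on half_space \<Phi>'"
    using \<Phi> by (auto simp: C1_on_def)
  \<comment> \<open>In the open half-space the one-sided derivative is the full one, so it yields
    the partial derivatives in \<open>dirac_op\<close>.\<close>
  have eq': "(\<Sum>\<mu>\<in>UNIV. genvector y \<mu> x \<odot> \<Phi>' x (axis \<mu> 1)) + (\<i> * of_real m) *s \<Phi> x = 0"
    if x: "x $ i1 > 0" for x
  proof -
    have "(\<Phi> has_derivative \<Phi>' x) (at x)"
      using d[of x] x by (simp add: at_within_half_space) (simp add: half_space_def)
    then have "pd \<mu> \<Phi> x = \<Phi>' x (axis \<mu> 1)" for \<mu>
      by (simp add: pd_def frechet_derivative_at[symmetric])
    then show ?thesis using eq[OF x] by (simp add: dirac_op_def)
  qed
  show ?thesis
  proof (cases "\<forall>x. y i1 i1 x > 0")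
    case True
    show ?thesis
      by (rule free_dirac_unique_future[where y = y and \<Phi> = \<Phi> and \<Phi>' = \<Phi>' and m = m])
        (fact y spec[OF True] d c' eq' z p)+
  next
    case False
    with smooth_tetrad_time_oriented[OF y] have neg: "- y i1 i1 x > 0" for x by auto
    have gv: "genvector (\<lambda>\<mu> a x. - y \<mu> a x) \<mu> x = - genvector y \<mu> x" for \<mu> x
      by (simp add: genvector_def sum_negf)
    have "(\<Sum>\<mu>\<in>UNIV. genvector (\<lambda>\<mu> a x. - y \<mu> a x) \<mu> x \<odot> \<Phi>' x (axis \<mu> 1)) + (\<i> * of_real (- m)) *s \<Phi> x = 0"
      if "x $ i1 > 0" for x
    proof -
      have *: "(\<i> * of_real (- m)) *s \<Phi> x = - ((\<i> * of_real m) *s \<Phi> x)"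
        unfolding of_real_minus mult_minus_right by (rule vector_smult_lneg)
      show ?thesis
        by (simp only: gv cl_mult_minus_left sum_negf * minus_add_distrib[symmetric] eq'[OF that] minus_zero)
    qed
    note eq'' = this
    show ?thesis
      by (rule free_dirac_unique_future[where y = "\<lambda>\<mu> a x. - y \<mu> a x" and \<Phi> = \<Phi> and \<Phi>' = \<Phi>' and m = "- m"])
        (fact smooth_tetrad_uminus[OF y] neg d c' eq'' z p)+
  qed
qed (rule z)

subsection \<open>Reduction to the free equation\<close>

text \<open>The partial derivatives are the values of the derivative on the standard basis, so the
  derivative is zero everywhere.\<close>

lemma hermitian_idempotent_constant:
  assumes "hermitian_idempotent t"
  shows "t x = t 0"
proof -
  have "(t has_derivative (\<lambda>_. 0)) (at z)" for z
  proof -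
    have d: "(t has_derivative frechet_derivative t (at z)) (at z)"
      using assms by (simp add: hermitian_idempotent_def differentiable_on_def frechet_derivative_works)
    then have lin: "linear (frechet_derivative t (at z))" by (rule has_derivative_linear)
    have "frechet_derivative t (at z) = (\<lambda>_. 0)"
    proof (rule linear_eq_stdbasis[OF lin linear_zero])
      fix b :: "'a pt" assume "b \<in> Basis"
      then obtain \<mu> where "b = axis \<mu> 1" by (auto simp: Basis_vec_def)
      then show "frechet_derivative t (at z) b = 0"
        using assms by (simp add: hermitian_idempotent_def pd_def)
    qed
    with d show ?thesis by simp
  qed
  then obtain k where "\<And>x. t x = k"
    using has_derivative_zero_constant[of UNIV t] by auto
  then show ?thesis by simp
qed

text \<open>Right multiplication by a constant commutes with differentiation and with left
  multiplication by the genvector, while \<open>A \<mu> x \<odot> s = 0\<close> kills the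
  potential.\<close>

lemma dirac_op_mult_right:
  assumes "\<Psi> differentiable at x" and A: "\<And>\<mu>. A \<mu> x \<odot> s = 0"
  shows "dirac_op y (\<lambda>_ _. 0) m (\<lambda>x. \<Psi> x \<odot> s) x = dirac_op y A m \<Psi> x \<odot> s"
proof -
  have "((\<lambda>x. \<Psi> x \<odot> s) has_derivative (\<lambda>h. frechet_derivative \<Psi> (at x) h \<odot> s)) (at x)"
    using assms(1) by (intro bounded_linear.has_derivative[OF bounded_linear_cl_mult_right])
      (simp add: frechet_derivative_works)
  then have "pd \<mu> (\<lambda>x. \<Psi> x \<odot> s) x = pd \<mu> \<Psi> x \<odot> s" for \<mu>
    by (simp add: pd_def frechet_derivative_at[symmetric])
  then show ?thesis
    by (simp add: dirac_op_def cl_mult_add_left cl_mult_sum_left cl_mult_scale_left cl_mult_assoc A)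
qed

lemma C1_on_bounded_linear:
  assumes L: "bounded_linear L" and f: "C1_on S f"
  shows "C1_on S (\<lambda>x. L (f x))"
proof -
  interpret bounded_linear L by (rule L)
  obtain f' where f': "\<And>x. x \<in> S \<Longrightarrow> (f has_derivative blinfun_apply (f' x)) (at x within S)"
    "continuous_on S f'"
    using f by (auto simp: C1_on_def)
  have L_app: "blinfun_apply (Blinfun L) = L" by (rule bounded_linear_Blinfun_apply[OF L])
  have "((\<lambda>x. L (f x)) has_derivative blinfun_apply (Blinfun L o\<^sub>L f' x)) (at x within S)" if "x \<in> S" for x
  proof -
    have "blinfun_apply (Blinfun L o\<^sub>L f' x) = (\<lambda>h. L (f' x h))"
      by (simp add: fun_eq_iff L_app)
    then show ?thesis using has_derivative[OF f'(1)[OF that]] by simp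
  qed
  moreover have "continuous_on S (\<lambda>x. Blinfun L o\<^sub>L f' x)"
    by (intro continuous_intros f'(2) bounded_bilinear.continuous_on[OF bounded_bilinear_blinfun_compose])
  ultimately show ?thesis
    unfolding C1_on_def by (intro exI[of _ "\<lambda>x. Blinfun L o\<^sub>L f' x"] conjI ballI)
qed

theorem theorem1:
  fixes y :: "'n::{finite,linorder} \<Rightarrow> 'n \<Rightarrow> 'n pt \<Rightarrow> real"
    and t :: "'n genform" and m :: real
    and A :: "'n \<Rightarrow> 'n genform" and \<psi>0 :: "'n genform"
  assumes "CARD('n) \<ge> 2" and "even (CARD('n))"
    and "smooth_tetrad y"
    and "hermitian_idempotent t"
    and "\<And>\<mu>. A \<mu> \<in> L_set UNIV t"
    and "\<psi>0 \<in> I_set UNIV t" and "initial_data \<psi>0"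
  shows "(\<forall>\<psi>. solves_P1 y t A m \<psi>0 \<psi> \<longrightarrow> solves_P2 y A m \<psi>0 \<psi>) \<and>
         (\<forall>\<Psi>. solves_P2 y A m \<psi>0 \<Psi> \<longrightarrow> \<Psi> \<in> I_set half_space t \<and> solves_P1 y t A m \<psi>0 \<Psi>)"
proof (intro conjI allI impI)
  fix \<psi> assume "solves_P1 y t A m \<psi>0 \<psi>"
  then show "solves_P2 y A m \<psi>0 \<psi>" by (simp add: solves_P1_def solves_P2_def)
next
  fix \<Psi> assume P2: "solves_P2 y A m \<psi>0 \<Psi>"
  \<comment> \<open>The complementary idempotent: X = X t holds exactly when X s = 0, so membership
    in I(t) becomes the vanishing of \<Psi> s.\<close>
  define s where "s = e_unit - t 0"
  have t: "t x = t 0" for x by (rule hermitian_idempotent_constant[OF assms(4)])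
  have mult_s: "X \<odot> s = X - X \<odot> t x" for X x
    using t[of x] by (simp add: s_def cl_mult_diff_right)
  have "\<Psi> x \<odot> s = 0" if "x \<in> half_space" for x
  proof (rule free_dirac_unique[OF assms(3), where \<Phi> = "\<lambda>x. \<Psi> x \<odot> s"])
    show "C1_on half_space (\<lambda>x. \<Psi> x \<odot> s)"
      using P2 by (intro C1_on_bounded_linear[OF bounded_linear_cl_mult_right]) (simp add: solves_P2_def)
  next
    fix x :: "'n pt" assume x: "x $ i1 > 0"
    then have xH: "x \<in> half_space" by (simp add: half_space_def)
    have "\<Psi> differentiable at x within half_space"
      using P2 xH by (auto simp: solves_P2_def C1_on_def differentiable_def)
    then have "\<Psi> differentiable at x" by (simp add: at_within_half_space[OF x])
    \<comment> \<open>L(t) is contained in I(t), so \<open>s\<close> annihilates the potential from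
      the right.\<close>
    moreover have "A \<mu> x \<odot> s = 0" for \<mu>
      using assms(5)[of \<mu>] by (simp add: mult_s[of _ x] L_set_def K_set_def I_set_def)
    ultimately have "dirac_op y (\<lambda>_ _. 0) m (\<lambda>x. \<Psi> x \<odot> s) x = dirac_op y A m \<Psi> x \<odot> s"
      by (rule dirac_op_mult_right)
    with P2 x show "dirac_op y (\<lambda>_ _. 0) m (\<lambda>x. \<Psi> x \<odot> s) x = 0" by (simp add: solves_P2_def)
  next
    fix x :: "'n pt" assume "x $ i1 = 0"
    with P2 assms(6) show "\<Psi> x \<odot> s = 0"
      by (simp add: mult_s[of _ x] solves_P2_def I_set_def)
  qed (rule that)
  then have "\<Psi> x = \<Psi> x \<odot> t x" if "x \<in> half_space" for x
    using that mult_s[of "\<Psi> x" x] by simp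
  then show I: "\<Psi> \<in> I_set half_space t" by (simp add: I_set_def)
  with P2 show "solves_P1 y t A m \<psi>0 \<Psi>" by (simp add: solves_P1_def solves_P2_def)
qed

end
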